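(* Let $\Omega\subset\mathbb{C}^n$ be a bounded domain. Then $$\mathcal{D}(\Omega)\le\mathcal{R}(\Omega)\le\beta(\Omega),$$ where $\mathcal{D}(\Omega)$, $\mathcal{R}(\Omega)$ and $\beta(\Omega)$ are the duality index, the regularity index and the integrability index of $\Omega$, respectively.
   Context: For a bounded domain $\Omega\subset\mathbb{C}^n$ and $1\le r<\infty$, $\mathcal{A}^r(\Omega)=\{f\in L^r(\Omega): f \text{ is holomorphic in }\Omega\}$ (Lebesgue measure), with the $L^r$ norm; $\mathcal{A}^r(\Omega)'$ is its Banach space dual. Write $\langle f,g\rangle=\int_\Omega f\overline g\,dV$. The Bergman kernel is $K(w,z)=K_z(w)$, where $K_z\in\mathcal{A}^2(\Omega)$ is the unique function with $f(z)=\langle f,K_z\rangle$ for all $f\in\mathcal{A}^2(\Omega)$. The Bergman projection $B:L^2(\Omega)\to\mathcal{A}^2(\Omega)$ is the orthogonal projection, $Bf(z)=\langle f,K(\cdot,z)\rangle$; since $\Omega$ is bounded, it is defined on $L^p(\Omega)\subset L^2(\Omega)$ for $p\ge2$. For conjugate exponents $r,s\in(1,\infty)$, $\frac1r+\frac1s=1$, the conjugate-linear map $\Phi_r:\mathcal{A}^s(\Omega)\to\mathcal{A}^r(\Omega)'$ is defined by $\Phi_r(g)(f)=\langle f,g\rangle$. The indices (suprema over finite exponents $p$, taking values in $[2,\infty]$) are: - $\beta(\Omega)=\sup\{p\ge2: K(\cdot,z)\in\mathcal{A}^p(\Omega)\text{ for all }z\in\Omega\}$; - $\mathcal{R}(\Omega)=\sup\{p\ge2: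 B:L^p(\Omega)\to\mathcal{A}^p(\Omega)\text{ is a bounded operator}\}$; - $\mathcal{D}(\Omega)=\sup\{p\ge2: \Phi_p\text{ and }\Phi_q\text{ are surjective, where }\frac1p+\frac1q=1\}$. *)

theory Defs
  imports "HOL-Analysis.Analysis"
begin

text \<open>
  Holomorphy in several variables: real Frechet differentiability with a complex-linear derivative.
\<close>
definition holomorphic_sv :: "(complex ^ 'n \<Rightarrow> complex) \<Rightarrow> (complex ^ 'n) set \<Rightarrow> bool" where
  "holomorphic_sv f \<Omega> \<longleftrightarrow>
     (\<forall>z\<in>\<Omega>. \<exists>D. (f has_derivative D) (at z) \<and> Vector_Spaces.linear (*s) (*) D)"

definition bounded_domain :: "(complex ^ 'n) set \<Rightarrow> bool" where
  "bounded_domain \<Omega> \<longleftrightarrow> open \<Omega> \<and> connected \<Omega> \<and> \<Omega> \<noteq> {} \<and> bounded \<Omega>"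

text \<open>
  \<open>Lr\<close> consists of functions rather than almost-everywhere classes, and values off \<open>\<Omega>\<close> are
  irrelevant; accordingly \<open>Lr_norm\<close> is only a seminorm on it.
\<close>
definition Lr :: "(complex ^ 'n) set \<Rightarrow> real \<Rightarrow> (complex ^ 'n \<Rightarrow> complex) set" where
  "Lr \<Omega> r = {f. f \<in> borel_measurable (lebesgue_on \<Omega>) \<and>
                integrable (lebesgue_on \<Omega>) (\<lambda>x. norm (f x) powr r)}"

definition Lr_norm :: "(complex ^ 'n) set \<Rightarrow> real \<Rightarrow> (complex ^ 'n \<Rightarrow> complex) \<Rightarrow> real" where
  "Lr_norm \<Omega> r f = (\<integral>x. norm (f x) powr r \<partial>lebesgue_on \<Omega>) powr (1 / r)"

definition pairing ::
  "(complex ^ 'n) set \<Rightarrow> (complex ^ 'n \<Rightarrow> complex) \<Rightarrow> (complex ^ 'n \<Rightarrow> complex) \<Rightarrow> complex" where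
  "pairing \<Omega> f g = (\<integral>x. f x * cnj (g x) \<partial>lebesgue_on \<Omega>)"

text \<open>
  A function on \<open>\<Omega>\<close> is represented by its extension by zero. Thus elements of a Bergman space that
  agree on \<open>\<Omega>\<close> are equal (which the uniqueness in the definite descriptions below relies on), and
  the space is closed under pointwise linear combinations.
\<close>
definition bergman_space :: "(complex ^ 'n) set \<Rightarrow> real \<Rightarrow> (complex ^ 'n \<Rightarrow> complex) set" where
  "bergman_space \<Omega> r = {f \<in> Lr \<Omega> r. holomorphic_sv f \<Omega> \<and> (\<forall>x. x \<notin> \<Omega> \<longrightarrow> f x = 0)}"

text \<open>
  Bounded complex-linear functionals, normalised to be \<open>undefined\<close> off the Bergman space so that
  equality of functionals is equality on that space.
\<close>
definition bergman_dual ::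
  "(complex ^ 'n) set \<Rightarrow> real \<Rightarrow> ((complex ^ 'n \<Rightarrow> complex) \<Rightarrow> complex) set" where
  "bergman_dual \<Omega> r = {l \<in> extensional (bergman_space \<Omega> r).
     (\<forall>f\<in>bergman_space \<Omega> r. \<forall>g\<in>bergman_space \<Omega> r. l (\<lambda>x. f x + g x) = l f + l g) \<and>
     (\<forall>c. \<forall>f\<in>bergman_space \<Omega> r. l (\<lambda>x. c * f x) = c * l f) \<and>
     (\<exists>C. \<forall>f\<in>bergman_space \<Omega> r. norm (l f) \<le> C * Lr_norm \<Omega> r f)}"

definition bergman_Phi ::
  "(complex ^ 'n) set \<Rightarrow> real \<Rightarrow> (complex ^ 'n \<Rightarrow> complex) \<Rightarrow> (complex ^ 'n \<Rightarrow> complex) \<Rightarrow> complex" where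
  "bergman_Phi \<Omega> r g = restrict (\<lambda>f. pairing \<Omega> f g) (bergman_space \<Omega> r)"

text \<open>\<open>bergman_kernel \<Omega> w z\<close> is $K(w,z) = K_z(w)$; it is meaningful for \<open>z \<in> \<Omega>\<close> only.\<close>
definition bergman_kernel ::
  "(complex ^ 'n) set \<Rightarrow> complex ^ 'n \<Rightarrow> complex ^ 'n \<Rightarrow> complex" where
  "bergman_kernel \<Omega> w z =
     (THE k. k \<in> bergman_space \<Omega> 2 \<and> (\<forall>f\<in>bergman_space \<Omega> 2. f z = pairing \<Omega> f k)) w"

text \<open>
  The orthogonal projection of $L^2(\Omega)$ onto the Bergman space: the element \<open>h\<close> for which
  \<open>f - h\<close> is orthogonal to that space.
\<close>
definition bergman_projection ::
  "(complex ^ 'n) set \<Rightarrow> (complex ^ 'n \<Rightarrow> complex) \<Rightarrow> (complex ^ 'n \<Rightarrow> complex)" where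
  "bergman_projection \<Omega> f =
     (THE h. h \<in> bergman_space \<Omega> 2 \<and>
             (\<forall>g\<in>bergman_space \<Omega> 2. pairing \<Omega> (\<lambda>x. f x - h x) g = 0))"

definition bergman_projection_bounded :: "(complex ^ 'n) set \<Rightarrow> real \<Rightarrow> bool" where
  "bergman_projection_bounded \<Omega> p \<longleftrightarrow>
     bergman_projection \<Omega> \<in> Lr \<Omega> p \<rightarrow> bergman_space \<Omega> p \<and>
     (\<exists>C. \<forall>f\<in>Lr \<Omega> p. Lr_norm \<Omega> p (bergman_projection \<Omega> f) \<le> C * Lr_norm \<Omega> p f)"

definition integrability_index :: "(complex ^ 'n) set \<Rightarrow> ereal" where
  "integrability_index \<Omega> =
     Sup {ereal p | p. p \<ge> 2 \<and> (\<forall>z\<in>\<Omega>. (\<lambda>w. bergman_kernel \<Omega> w z) \<in> bergman_space \<Omega> p)}"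

definition regularity_index :: "(complex ^ 'n) set \<Rightarrow> ereal" where
  "regularity_index \<Omega> = Sup {ereal p | p. p \<ge> 2 \<and> bergman_projection_bounded \<Omega> p}"

definition duality_index :: "(complex ^ 'n) set \<Rightarrow> ereal" where
  "duality_index \<Omega> =
     Sup {ereal p | p q. p \<ge> 2 \<and> 1 / p + 1 / q = 1 \<and>
            bergman_Phi \<Omega> p ` bergman_space \<Omega> q = bergman_dual \<Omega> p \<and>
            bergman_Phi \<Omega> q ` bergman_space \<Omega> p = bergman_dual \<Omega> q}"

end

theory Submission
  imports Defs "HOL-Complex_Analysis.Cauchy_Integral_Formula"
begin

text \<open>
  The second inequality holds because the Bergman kernel is itself a Bergman projection. A holomorphic
  function has at \<open>z\<close> its mean value over any ball around \<open>z\<close> with closure in \<open>\<Omega>\<close>, so evaluation at \<open>z\<close>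
  is the pairing with the normalised indicator \<open>\<phi>\<close> of the ball, and the defining property of the kernel
  says precisely that \<open>K(\<cdot>,z) = B \<phi>\<close> (\<open>bergman_kernel_eq_projection\<close>). As \<open>\<phi>\<close> is bounded, it lies in
  every $L^p$, and a projection that maps $L^p$ to the Bergman space puts \<open>K(\<cdot>,z)\<close> there.

  For the first inequality take \<open>f\<close> in $L^p$ with $p \ge 2$ and let \<open>q\<close> be the conjugate exponent. By Hoelder,
  \<open>h \<mapsto> \<langle>h,f\<rangle>\<close> is a bounded functional on the Bergman space of exponent \<open>q\<close>; surjectivity
  of $\Phi_q$ represents it by some \<open>g\<close> in the Bergman space of exponent \<open>p\<close>. Since $q \le 2 \le p$ and \<open>\<Omega>\<close> is
  bounded, testing with square-integrable \<open>h\<close> shows that \<open>f - g\<close> is orthogonal to the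
  Hilbert-space Bergman space, so \<open>B f = g\<close>. Thus \<open>B\<close> maps $L^p$ into the Bergman space.
  Its boundedness then follows from the uniform boundedness principle
  (\<open>Lr_uniform_boundedness\<close>), applied to the functionals \<open>f \<mapsto> \<langle>B f,h\<rangle>\<close> with \<open>h\<close> bounded of
  $L^q$ norm at most 1: each is continuous on $L^p$ because \<open>B\<close> contracts the $L^2$ norm, at each \<open>f\<close> they
  are bounded by the $L^p$ norm of \<open>B f\<close>, and together they compute that norm
  (\<open>Lr_norm_le_dual\<close>).

  Both arguments presuppose that the definite descriptions of \<open>B f\<close> and \<open>K(\<cdot>,z)\<close> denote. Existence comes
  from minimising the distance to the Bergman space (\<open>orthogonal_projection_exists\<close>): a minimising
  sequence is Cauchy by the parallelogram law, hence locally uniformly Cauchy by the mean value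
  property, and a locally uniform limit of holomorphic functions is holomorphic. Uniqueness
  holds because point evaluations are bounded, so that a Bergman function of norm zero
  vanishes identically.
\<close>

section \<open>Seminormed spaces of integrable functions\<close>

text \<open>
  \<open>powr_convex\<close> extended to the end point 0 of the half-line, where the value of a function may well lie.
\<close>
lemma powr_convex_combination:
  fixes r s t x y :: real
  assumes "r \<ge> 1" "s > 0" "t > 0" "s + t = 1" "x \<ge> 0" "y \<ge> 0"
  shows "(s * x + t * y) powr r \<le> s * x powr r + t * y powr r"
proof -
  have small: "c powr r \<le> c" if "0 < c" "c \<le> 1" for c
    using powr_mono'[of 1 r c] that assms(1) by simp
  consider "x = 0" | "y = 0" | "x > 0" "y > 0" using assms by linarith
  thus ?thesis
  proof cases
    case 1
    thus ?thesis using assms small[of t] by (simp add: powr_mult mult_right_mono)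
  next
    case 2
    thus ?thesis using assms small[of s] by (simp add: powr_mult mult_right_mono)
  next
    case 3
    thus ?thesis using powr_convex[OF assms(1)] assms unfolding convex_on_def by simp
  qed
qed

lemma Lr_measurable: "f \<in> Lr \<Omega> r \<Longrightarrow> f \<in> borel_measurable (lebesgue_on \<Omega>)"
  by (simp add: Lr_def)

lemma Lr_norm_nonneg: "Lr_norm \<Omega> r f \<ge> 0"
  by (simp add: Lr_norm_def)

lemma Lr_norm_powr:
  assumes "r > 0"
  shows "Lr_norm \<Omega> r f powr r = (\<integral>x. norm (f x) powr r \<partial>lebesgue_on \<Omega>)"
  using assms by (simp add: Lr_norm_def powr_powr integral_nonneg_AE)

lemma nn_integral_Lr:
  assumes "f \<in> Lr \<Omega> r" "r > 0"
  shows "(\<integral>\<^sup>+x. ennreal (norm (f x) powr r) \<partial>lebesgue_on \<Omega>) = ennreal (Lr_norm \<Omega> r f powr r)"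
  using assms by (subst nn_integral_eq_integral) (auto simp: Lr_def Lr_norm_powr)

text \<open>
  Membership is established through nonnegative integrals, which make sense before integrability is known.
\<close>
lemma Lr_nn_integralI:
  assumes f: "f \<in> borel_measurable (lebesgue_on \<Omega>)" and "r > 0" "c \<ge> 0"
    and le: "(\<integral>\<^sup>+x. ennreal (norm (f x) powr r) \<partial>lebesgue_on \<Omega>) \<le> ennreal (c powr r)"
  shows "f \<in> Lr \<Omega> r" and "Lr_norm \<Omega> r f \<le> c"
proof -
  have i: "integrable (lebesgue_on \<Omega>) (\<lambda>x. norm (f x) powr r)"
    using f le by (intro integrableI_bounded) (auto simp: top.extremum_strict le_less_trans)
  show fL: "f \<in> Lr \<Omega> r" using f i by (simp add: Lr_def)
  have "Lr_norm \<Omega> r f powr r \<le> c powr r"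
    using le nn_integral_Lr[OF fL \<open>r > 0\<close>] by (simp add: ennreal_le_iff)
  thus "Lr_norm \<Omega> r f \<le> c"
    using powr_less_mono2[of r c "Lr_norm \<Omega> r f"] assms by force
qed

lemma Lr_cmult:
  assumes "f \<in> Lr \<Omega> r"
  shows "(\<lambda>x. c * f x) \<in> Lr \<Omega> r"
  using assms by (auto simp: Lr_def norm_mult powr_mult)

lemma Lr_norm_cmult:
  assumes "r > 0"
  shows "Lr_norm \<Omega> r (\<lambda>x. c * f x) = norm c * Lr_norm \<Omega> r f"
  using assms by (simp add: Lr_norm_def norm_mult powr_mult powr_powr)

text \<open>
  Minkowski's inequality in homogeneous form: \<open>\<bar>f + g\<bar> / (a + b)\<close> is at most the convex combination of
  \<open>\<bar>f\<bar> / a\<close> and \<open>\<bar>g\<bar> / b\<close> with weights \<open>a / (a + b)\<close> and \<open>b / (a + b)\<close>, so convexity of the power bounds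
  the integral of its \<open>r\<close>-th power by 1. Positive upper bounds \<open>a\<close>, \<open>b\<close> in place of the norms avoid dividing by a norm that is zero.
\<close>
lemma Lr_add_bound:
  assumes r: "r \<ge> 1" and f: "f \<in> Lr \<Omega> r" and g: "g \<in> Lr \<Omega> r"
    and a: "a > 0" "Lr_norm \<Omega> r f \<le> a" and b: "b > 0" "Lr_norm \<Omega> r g \<le> b"
  shows "(\<lambda>x. f x + g x) \<in> Lr \<Omega> r" and "Lr_norm \<Omega> r (\<lambda>x. f x + g x) \<le> a + b"
proof -
  let ?M = "lebesgue_on \<Omega>"
  have [measurable]: "f \<in> borel_measurable ?M" "g \<in> borel_measurable ?M"
    using f g by (auto simp: Lr_def)
  define K where "K = (a + b) powr r"
  define A where "A = K * (a / (a + b)) / a powr r"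
  define B where "B = K * (b / (a + b)) / b powr r"
  have ab1: "a / (a + b) + b / (a + b) = 1"
    using a b by (simp flip: add_divide_distrib)
  have nn: "A \<ge> 0" "B \<ge> 0" "K \<ge> 0" using a b by (auto simp: A_def B_def K_def)
  have pt: "norm (f x + g x) powr r \<le> A * norm (f x) powr r + B * norm (g x) powr r" for x
  proof -
    have "norm (f x + g x) powr r \<le> (norm (f x) + norm (g x)) powr r"
      using r by (intro powr_mono2 norm_triangle_ineq) auto
    also have "norm (f x) + norm (g x)
        = (a + b) * (a / (a + b) * (norm (f x) / a) + b / (a + b) * (norm (g x) / b))"
    proof -
      have c: "k * (s / k * (u / s)) = u" if "k \<noteq> 0" "s \<noteq> 0" for k s u :: real
        using that by simp
      have "a + b \<noteq> 0" "a \<noteq> 0" "b \<noteq> 0" using a b by auto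
      thus ?thesis by (simp only: distrib_left c[OF \<open>a + b \<noteq> 0\<close> \<open>a \<noteq> 0\<close>] c[OF \<open>a + b \<noteq> 0\<close> \<open>b \<noteq> 0\<close>])
    qed
    also have "\<dots> powr r = K * (a / (a + b) * (norm (f x) / a) + b / (a + b) * (norm (g x) / b)) powr r"
      by (simp only: K_def powr_mult)
    also have "\<dots> \<le> K * (a / (a + b) * (norm (f x) / a) powr r + b / (a + b) * (norm (g x) / b) powr r)"
      using a b r nn by (intro mult_left_mono powr_convex_combination ab1) auto
    also have "\<dots> = A * norm (f x) powr r + B * norm (g x) powr r"
      using a b by (simp add: A_def B_def powr_divide algebra_simps)
    finally show ?thesis .
  qed
  have "(\<integral>\<^sup>+x. ennreal (norm (f x + g x) powr r) \<partial>?M)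
      \<le> (\<integral>\<^sup>+x. ennreal A * ennreal (norm (f x) powr r) + ennreal B * ennreal (norm (g x) powr r) \<partial>?M)"
    using pt nn by (intro nn_integral_mono) (simp flip: ennreal_mult ennreal_plus)
  also have "\<dots> = ennreal A * ennreal (Lr_norm \<Omega> r f powr r) + ennreal B * ennreal (Lr_norm \<Omega> r g powr r)"
    using f g r by (subst nn_integral_add) (simp_all add: nn_integral_cmult nn_integral_Lr)
  also have "\<dots> \<le> ennreal A * ennreal (a powr r) + ennreal B * ennreal (b powr r)"
    using a b r by (intro add_mono mult_left_mono ennreal_leI powr_mono2) (auto simp: Lr_norm_nonneg)
  also have "\<dots> = ennreal (A * a powr r + B * b powr r)"
    using nn by (simp flip: ennreal_mult ennreal_plus)
  also have "A * a powr r + B * b powr r = K"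
  proof -
    have "A * a powr r = K * (a / (a + b))" "B * b powr r = K * (b / (a + b))"
      using a b by (simp_all add: A_def B_def)
    thus ?thesis by (simp only: distrib_left[symmetric] ab1 mult_1_right)
  qed
  finally have le: "(\<integral>\<^sup>+x. ennreal (norm (f x + g x) powr r) \<partial>?M) \<le> ennreal ((a + b) powr r)"
    by (simp add: K_def)
  show "(\<lambda>x. f x + g x) \<in> Lr \<Omega> r" "Lr_norm \<Omega> r (\<lambda>x. f x + g x) \<le> a + b"
    using Lr_nn_integralI[OF _ _ _ le] a b r by auto
qed

lemma Lr_add:
  assumes "r \<ge> 1" "f \<in> Lr \<Omega> r" "g \<in> Lr \<Omega> r"
  shows "(\<lambda>x. f x + g x) \<in> Lr \<Omega> r"
  using Lr_add_bound(1)[OF assms, of "Lr_norm \<Omega> r f + 1" "Lr_norm \<Omega> r g + 1"]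
    Lr_norm_nonneg[of \<Omega> r f] Lr_norm_nonneg[of \<Omega> r g] by simp

lemma Lr_norm_triangle:
  assumes "r \<ge> 1" "f \<in> Lr \<Omega> r" "g \<in> Lr \<Omega> r"
  shows "Lr_norm \<Omega> r (\<lambda>x. f x + g x) \<le> Lr_norm \<Omega> r f + Lr_norm \<Omega> r g"
proof (rule field_le_epsilon)
  fix e :: real assume "e > 0"
  thus "Lr_norm \<Omega> r (\<lambda>x. f x + g x) \<le> Lr_norm \<Omega> r f + Lr_norm \<Omega> r g + e"
    using Lr_add_bound(2)[OF assms, of "Lr_norm \<Omega> r f + e/2" "Lr_norm \<Omega> r g + e/2"]
      Lr_norm_nonneg[of \<Omega> r f] Lr_norm_nonneg[of \<Omega> r g] by simp
qed

lemma Lr_diff: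
  assumes "r \<ge> 1" "f \<in> Lr \<Omega> r" "g \<in> Lr \<Omega> r"
  shows "(\<lambda>x. f x - g x) \<in> Lr \<Omega> r"
  using Lr_add[OF assms(1,2) Lr_cmult[OF assms(3), of "-1"]] by simp

lemma Lr_norm_minus: "Lr_norm \<Omega> r (\<lambda>x. - f x) = Lr_norm \<Omega> r f"
  by (simp add: Lr_norm_def)

lemma Lr_zero: "(\<lambda>x. 0) \<in> Lr \<Omega> r"
  by (simp add: Lr_def)

lemma Lr_norm_zero: "Lr_norm \<Omega> r (\<lambda>x. 0) = 0"
  by (simp add: Lr_norm_def)

lemma Lr_sum:
  fixes k :: nat
  assumes "r \<ge> 1" "\<And>i. i < k \<Longrightarrow> f i \<in> Lr \<Omega> r"
  shows "(\<lambda>x. \<Sum>i<k. f i x) \<in> Lr \<Omega> r \<and> Lr_norm \<Omega> r (\<lambda>x. \<Sum>i<k. f i x) \<le> (\<Sum>i<k. Lr_norm \<Omega> r (f i))"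
  using assms(2)
proof (induction k)
  case 0
  thus ?case by (simp add: Lr_zero Lr_norm_zero)
next
  case (Suc k)
  hence IH: "(\<lambda>x. \<Sum>i<k. f i x) \<in> Lr \<Omega> r" "Lr_norm \<Omega> r (\<lambda>x. \<Sum>i<k. f i x) \<le> (\<Sum>i<k. Lr_norm \<Omega> r (f i))"
    by auto
  show ?case
    using Lr_add[OF assms(1) IH(1), of "f k"] Lr_norm_triangle[OF assms(1) IH(1), of "f k"] IH(2) Suc.prems[of k]
    by simp
qed

text \<open>
  Closed balls of the seminorm are closed under pointwise limits, by Fatou's lemma. Limits below
  are taken pointwise and controlled in norm in this way.
\<close>
lemma Lr_Fatou:
  assumes r: "r > 0" and f: "\<And>n. f n \<in> Lr \<Omega> r" and le: "\<forall>\<^sub>F n in sequentially. Lr_norm \<Omega> r (f n) \<le> c" and c: "c \<ge> 0"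
    and lim: "AE x in lebesgue_on \<Omega>. (\<lambda>n. f n x) \<longlonglongrightarrow> g x"
    and g: "g \<in> borel_measurable (lebesgue_on \<Omega>)"
  shows "g \<in> Lr \<Omega> r" and "Lr_norm \<Omega> r g \<le> c"
proof -
  let ?M = "lebesgue_on \<Omega>"
  have [measurable]: "f n \<in> borel_measurable ?M" for n using f by (auto simp: Lr_def)
  have "(\<integral>\<^sup>+x. ennreal (norm (g x) powr r) \<partial>?M) = (\<integral>\<^sup>+x. liminf (\<lambda>n. ennreal (norm (f n x) powr r)) \<partial>?M)"
  proof (rule nn_integral_cong_AE)
    show "AE x in ?M. ennreal (norm (g x) powr r) = liminf (\<lambda>n. ennreal (norm (f n x) powr r))"
      using lim
    proof eventually_elim
      case (elim x)
      have "(\<lambda>n. norm (f n x) powr r) \<longlonglongrightarrow> norm (g x) powr r"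
      proof (rule tendsto_powr2)
        show "\<forall>\<^sub>F n in sequentially. 0 \<le> norm (f n x)" by simp
      qed (use elim r in \<open>auto intro: tendsto_norm\<close>)
      hence "(\<lambda>n. ennreal (norm (f n x) powr r)) \<longlonglongrightarrow> ennreal (norm (g x) powr r)"
        by (rule tendsto_ennrealI)
      from lim_imp_Liminf[OF _ this] show ?case by simp
    qed
  qed
  also have "\<dots> \<le> liminf (\<lambda>n. \<integral>\<^sup>+x. ennreal (norm (f n x) powr r) \<partial>?M)"
    by (rule nn_integral_liminf) measurable
  also have "\<dots> \<le> ennreal (c powr r)"
  proof (rule Liminf_le)
    show "\<forall>\<^sub>F n in sequentially. (\<integral>\<^sup>+x. ennreal (norm (f n x) powr r) \<partial>?M) \<le> ennreal (c powr r)"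
      using le
    proof eventually_elim
      case (elim n)
      thus ?case using r by (simp add: nn_integral_Lr f Lr_norm_nonneg ennreal_leI powr_mono2)
    qed
  qed simp
  finally have le: "(\<integral>\<^sup>+x. ennreal (norm (g x) powr r) \<partial>?M) \<le> ennreal (c powr r)" .
  show "g \<in> Lr \<Omega> r" "Lr_norm \<Omega> r g \<le> c" using Lr_nn_integralI[OF g r c le] .
qed

text \<open>
  Young's inequality for \<open>\<bar>f\<bar> / a\<close> and \<open>\<bar>g\<bar> / b\<close>, integrated. As for Minkowski's inequality, positive upper
  bounds stand in for the norms.
\<close>
lemma Holder_pairing_bound:
  assumes pq: "p > 1" "1 / p + 1 / q = 1" and f: "f \<in> Lr \<Omega> q" and g: "g \<in> Lr \<Omega> p"
    and a: "a > 0" "Lr_norm \<Omega> q f \<le> a" and b: "b > 0" "Lr_norm \<Omega> p g \<le> b"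
  shows "integrable (lebesgue_on \<Omega>) (\<lambda>x. f x * cnj (g x))" and "norm (pairing \<Omega> f g) \<le> a * b"
proof -
  let ?M = "lebesgue_on \<Omega>"
  have q: "q > 1"
  proof -
    have "0 < 1/p" "1/p < 1" using pq(1) by auto
    hence "0 < 1/q" "1/q < 1" using pq(2) by linarith+
    thus ?thesis by (simp add: divide_less_eq split: if_splits)
  qed
  have [measurable]: "f \<in> borel_measurable ?M" "g \<in> borel_measurable ?M"
    using f g by (auto simp: Lr_def)
  have cnj[measurable]: "(\<lambda>x. cnj (g x)) \<in> borel_measurable ?M"
    by (rule borel_measurable_continuous_on[of cnj]) (auto intro: continuous_intros)
  have fi: "integrable ?M (\<lambda>x. norm (f x) powr q)" and gi: "integrable ?M (\<lambda>x. norm (g x) powr p)"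
    using f g by (auto simp: Lr_def)
  define h where "h = (\<lambda>x. a * b * (norm (f x) powr q / (a powr q * q) + norm (g x) powr p / (b powr p * p)))"
  have hi: "integrable ?M h" unfolding h_def using fi gi by auto
  have pt: "norm (f x * cnj (g x)) \<le> h x" for x
  proof -
    have "norm (f x) / a * (norm (g x) / b) \<le> (norm (f x) / a) powr q / q + (norm (g x) / b) powr p / p"
      using pq q a b by (intro Youngs_inequality) (auto simp: add.commute)
    hence "a * b * (norm (f x) / a * (norm (g x) / b)) \<le> a * b * ((norm (f x) / a) powr q / q + (norm (g x) / b) powr p / p)"
      using a b by (intro mult_left_mono) auto
    thus ?thesis using a b by (simp add: h_def norm_mult powr_divide)
  qed
  show int: "integrable ?M (\<lambda>x. f x * cnj (g x))"
    using hi by (rule Bochner_Integration.integrable_bound) (auto intro!: AE_I2 order_trans[OF pt])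
  have "norm (pairing \<Omega> f g) \<le> (\<integral>x. norm (f x * cnj (g x)) \<partial>?M)"
    unfolding pairing_def by (rule integral_norm_bound)
  also have "\<dots> \<le> (\<integral>x. h x \<partial>?M)"
    using int hi pt by (intro integral_mono) auto
  also have "\<dots> = a * b * (Lr_norm \<Omega> q f powr q / (a powr q * q) + Lr_norm \<Omega> p g powr p / (b powr p * p))"
    using fi gi pq q by (simp add: h_def Lr_norm_powr)
  also have "\<dots> \<le> a * b * (a powr q / (a powr q * q) + b powr p / (b powr p * p))"
    using a b pq q by (intro mult_left_mono add_mono divide_right_mono powr_mono2) (auto simp: Lr_norm_nonneg)
  also have "\<dots> = a * b" using a b pq by (simp add: add.commute)
  finally show "norm (pairing \<Omega> f g) \<le> a * b" .
qed

lemma integrable_pairing: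
  assumes "p > 1" "1 / p + 1 / q = 1" "f \<in> Lr \<Omega> q" "g \<in> Lr \<Omega> p"
  shows "integrable (lebesgue_on \<Omega>) (\<lambda>x. f x * cnj (g x))"
  using Holder_pairing_bound(1)[OF assms, of "Lr_norm \<Omega> q f + 1" "Lr_norm \<Omega> p g + 1"]
    Lr_norm_nonneg[of \<Omega> q f] Lr_norm_nonneg[of \<Omega> p g] by simp

lemma Holder_pairing:
  assumes "p > 1" "1 / p + 1 / q = 1" "f \<in> Lr \<Omega> q" "g \<in> Lr \<Omega> p"
  shows "norm (pairing \<Omega> f g) \<le> Lr_norm \<Omega> q f * Lr_norm \<Omega> p g"
proof (rule tendsto_lowerbound)
  show "((\<lambda>e. (Lr_norm \<Omega> q f + e) * (Lr_norm \<Omega> p g + e)) \<longlongrightarrow> Lr_norm \<Omega> q f * Lr_norm \<Omega> p g) (at_right 0)"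
    by (auto intro!: tendsto_eq_intros)
  show "\<forall>\<^sub>F e in at_right 0. norm (pairing \<Omega> f g) \<le> (Lr_norm \<Omega> q f + e) * (Lr_norm \<Omega> p g + e)"
    using eventually_at_right_less[of 0]
  proof eventually_elim
    case (elim e)
    thus ?case using Holder_pairing_bound(2)[OF assms, of "Lr_norm \<Omega> q f + e" "Lr_norm \<Omega> p g + e"]
      Lr_norm_nonneg[of \<Omega> q f] Lr_norm_nonneg[of \<Omega> p g] by simp
  qed
qed simp

text \<open>
  Pointwise \<open>\<bar>f\<bar>\<^sup>q \<le> 1 + \<bar>f\<bar>\<^sup>p\<close>. On a set of finite measure this bounds the \<open>q\<close>-norm on the unit ball
  of the \<open>p\<close>-norm, and the general bound follows by scaling.
\<close>
lemma Lr_inclusion: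
  assumes fin: "emeasure lebesgue \<Omega> < \<infinity>" and \<Omega>: "\<Omega> \<in> sets lebesgue" and qp: "1 \<le> q" "q \<le> p"
  shows "\<exists>C\<ge>0. \<forall>f\<in>Lr \<Omega> p. f \<in> Lr \<Omega> q \<and> Lr_norm \<Omega> q f \<le> C * Lr_norm \<Omega> p f"
proof -
  let ?M = "lebesgue_on \<Omega>"
  define V where "V = measure lebesgue \<Omega>"
  have "emeasure ?M (space ?M) = emeasure lebesgue \<Omega>"
    using \<Omega> by (subst emeasure_restrict_space) auto
  hence V: "emeasure ?M (space ?M) = ennreal V"
    using fin unfolding V_def by (subst (asm) emeasure_eq_ennreal_measure) auto
  have V0: "V \<ge> 0" by (simp add: V_def)
  define C where "C = (V + 1) powr (1/q)"
  have Cq: "C powr q = V + 1" using V0 qp by (simp add: C_def powr_powr)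
  have C0: "C \<ge> 0" by (simp add: C_def)
  have unit: "f \<in> Lr \<Omega> q \<and> Lr_norm \<Omega> q f \<le> C" if f: "f \<in> Lr \<Omega> p" "Lr_norm \<Omega> p f \<le> 1" for f
  proof -
    have [measurable]: "f \<in> borel_measurable ?M" using f by (auto simp: Lr_def)
    have pt: "norm (f x) powr q \<le> 1 + norm (f x) powr p" for x
    proof (cases "norm (f x) \<le> 1")
      case True
      hence "norm (f x) powr q \<le> 1 powr q" using qp by (intro powr_mono2) auto
      thus ?thesis by (simp add: add_increasing2)
    next
      case False
      hence "norm (f x) powr q \<le> norm (f x) powr p" using qp by (intro powr_mono) auto
      thus ?thesis by simp
    qed
    have "(\<integral>\<^sup>+x. ennreal (norm (f x) powr q) \<partial>?M) \<le> (\<integral>\<^sup>+x. 1 + ennreal (norm (f x) powr p) \<partial>?M)"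
      using pt by (intro nn_integral_mono) (simp flip: ennreal_1 ennreal_plus)
    also have "\<dots> = ennreal V + ennreal (Lr_norm \<Omega> p f powr p)"
      using f qp V by (subst nn_integral_add) (auto simp: nn_integral_Lr)
    also have "\<dots> \<le> ennreal (V + 1)"
      using V0 f qp powr_mono2[of p "Lr_norm \<Omega> p f" 1] by (simp add: Lr_norm_nonneg flip: ennreal_plus)
    finally show ?thesis
      using Lr_nn_integralI[of f \<Omega> q C] qp Cq C0 by auto
  qed
  have "f \<in> Lr \<Omega> q \<and> Lr_norm \<Omega> q f \<le> C * Lr_norm \<Omega> p f" if f: "f \<in> Lr \<Omega> p" for f
  proof -
    have sc: "f \<in> Lr \<Omega> q \<and> Lr_norm \<Omega> q f \<le> C * a" if a: "a > 0" "Lr_norm \<Omega> p f \<le> a" for a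
    proof -
      let ?g = "\<lambda>x. complex_of_real (1/a) * f x"
      have "Lr_norm \<Omega> p ?g \<le> 1" 
        using a qp by (subst Lr_norm_cmult) (auto simp: norm_divide field_simps)
      with unit[OF Lr_cmult[OF f]] have g: "?g \<in> Lr \<Omega> q" "Lr_norm \<Omega> q ?g \<le> C" by blast+
      have "(\<lambda>x. complex_of_real a * ?g x) \<in> Lr \<Omega> q" by (rule Lr_cmult[OF g(1)])
      moreover have "(\<lambda>x. complex_of_real a * ?g x) = f" using a by auto
      moreover have "Lr_norm \<Omega> q (\<lambda>x. complex_of_real a * ?g x) = a * Lr_norm \<Omega> q ?g"
        using a qp by (subst Lr_norm_cmult) auto
      ultimately show ?thesis using g(2) a by (simp add: mult.commute)
    qed
    have "Lr_norm \<Omega> q f \<le> C * Lr_norm \<Omega> p f"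
    proof (rule tendsto_lowerbound)
      show "((\<lambda>e. C * (Lr_norm \<Omega> p f + e)) \<longlongrightarrow> C * Lr_norm \<Omega> p f) (at_right 0)"
        by (auto intro!: tendsto_eq_intros)
      show "\<forall>\<^sub>F e in at_right 0. Lr_norm \<Omega> q f \<le> C * (Lr_norm \<Omega> p f + e)"
        using eventually_at_right_less[of 0]
      proof eventually_elim
        case (elim e)
        thus ?case using sc[of "Lr_norm \<Omega> p f + e"] Lr_norm_nonneg[of \<Omega> p f] by simp
      qed
    qed simp
    thus ?thesis using sc[of "Lr_norm \<Omega> p f + 1"] Lr_norm_nonneg[of \<Omega> p f] by simp
  qed
  thus ?thesis using C0 by blast
qed

text \<open>
  The extremal test function in Hoelder's inequality is \<open>\<bar>u\<bar> powr (p - 2) * u\<close>. It is set to zero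
  where \<open>\<bar>u\<bar>\<close> is large, which makes it bounded; dominated convergence removes the cut-off.
\<close>
lemma Lr_norm_le_dual:
  assumes pq: "p > 1" "1 / p + 1 / q = 1" and u: "u \<in> Lr \<Omega> p" and c: "c \<ge> 0"
    and bd: "\<And>h m. \<lbrakk>h \<in> Lr \<Omega> q; \<And>x. norm (h x) \<le> m; Lr_norm \<Omega> q h \<le> 1\<rbrakk> \<Longrightarrow> norm (pairing \<Omega> u h) \<le> c"
  shows "Lr_norm \<Omega> p u \<le> c"
proof -
  let ?M = "lebesgue_on \<Omega>"
  have q: "q > 1" and pq': "(p - 1) * q = p" 
  proof -
    have "0 < 1/p" "1/p < 1" using pq(1) by auto
    hence "0 < 1/q" "1/q < 1" using pq(2) by linarith+
    thus "q > 1" by (simp add: divide_less_eq split: if_splits)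
    thus "(p - 1) * q = p" using pq by (simp add: field_simps)
  qed
  have [measurable]: "u \<in> borel_measurable ?M" using u by (auto simp: Lr_def)
  have ui: "integrable ?M (\<lambda>x. norm (u x) powr p)" using u by (auto simp: Lr_def)
  define t where "t = (\<lambda>(m::nat) x. if norm (u x) \<le> real m then norm (u x) powr p else 0)"
  have tm[measurable]: "t m \<in> borel_measurable ?M" for m unfolding t_def by measurable
  have ti: "integrable ?M (t m)" for m
    using ui by (rule Bochner_Integration.integrable_bound) (auto simp: t_def)
  have t0: "t m x \<ge> 0" for m x by (simp add: t_def)
  define I where "I = (\<lambda>m. \<integral>x. t m x \<partial>?M)"
  have I0: "I m \<ge> 0" for m by (simp add: I_def t0)
  have Ic: "I m \<le> c powr p" for m
  proof (cases "I m = 0")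
    case True
    thus ?thesis by simp
  next
    case False
    hence Ip: "I m > 0" using I0[of m] by simp
    define h where "h = (\<lambda>x. if norm (u x) \<le> real m then complex_of_real (norm (u x) powr (p - 2)) * u x else 0)"
    have hm[measurable]: "h \<in> borel_measurable ?M" unfolding h_def by measurable
    have nh: "norm (h x) = (if norm (u x) \<le> real m then norm (u x) powr (p - 1) else 0)" for x
      using powr_mult_base[of "norm (u x)" "p - 2"] by (simp add: h_def norm_mult mult.commute)
    have hq: "norm (h x) powr q = t m x" for x
      by (simp add: nh t_def powr_powr pq')
    have hL: "h \<in> Lr \<Omega> q" using ti by (simp add: Lr_def hq)
    have hn: "Lr_norm \<Omega> q h = I m powr (1/q)" by (simp add: Lr_norm_def hq I_def)
    have uh: "u x * cnj (h x) = of_real (t m x)" for x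
    proof -
      have "u x * cnj (of_real (norm (u x) powr (p - 2)) * u x) = of_real (norm (u x) powr (p - 2)) * (u x * cnj (u x))"
        by (simp add: mult_ac)
      also have "u x * cnj (u x) = of_real (norm (u x) * norm (u x))"
        by (metis complex_norm_square of_real_mult power2_eq_square of_real_power)
      also have "of_real (norm (u x) powr (p - 2)) * complex_of_real (norm (u x) * norm (u x)) = of_real (norm (u x) powr (p - 2) * (norm (u x) * norm (u x)))"
        by simp
      also have "norm (u x) powr (p - 2) * (norm (u x) * norm (u x)) = norm (u x) powr p"
        by (cases "u x = 0") (simp_all add: powr_diff power2_eq_square)
      finally show ?thesis by (simp add: h_def t_def)
    qed
    \<comment> \<open>normalisation to unit norm; pairing with \<open>u\<close> then gives \<open>I m powr (1 - 1/q)\<close>\<close>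
    define k where "k = (\<lambda>x. complex_of_real (I m powr (- (1/q))) * h x)"
    have kL: "k \<in> Lr \<Omega> q" unfolding k_def by (rule Lr_cmult[OF hL])
    have "Lr_norm \<Omega> q k = I m powr (- (1/q)) * I m powr (1/q)"
      using q unfolding k_def by (subst Lr_norm_cmult) (auto simp: hn)
    hence kn: "Lr_norm \<Omega> q k \<le> 1" using Ip by (simp flip: powr_add)
    have "norm (k x) \<le> I m powr (- (1/q)) * real m powr (p - 1)" for x
      using pq by (auto simp: k_def norm_mult nh intro!: mult_left_mono powr_mono2)
    hence le: "norm (pairing \<Omega> u k) \<le> c" by (rule bd[OF kL _ kn])
    have "pairing \<Omega> u k = (\<integral>x. of_real (I m powr (- (1/q)) * t m x) \<partial>?M)"
      unfolding pairing_def by (rule Bochner_Integration.integral_cong) (simp_all add: k_def uh[symmetric] mult_ac)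
    also have "\<dots> = of_real (I m powr (- (1/q)) * I m)"
      unfolding I_def by (simp flip: of_real_mult)
    also have "I m powr (- (1/q)) * I m = I m powr (1/p)"
    proof -
      have "I m powr (- (1/q)) * I m powr 1 = I m powr (- (1/q) + 1)" by (rule powr_add[symmetric])
      moreover have "- (1/q) + 1 = 1/p" using pq by simp
      ultimately show ?thesis using Ip by simp
    qed
    finally have "I m powr (1/p) \<le> c" using le by simp
    hence "(I m powr (1/p)) powr p \<le> c powr p" using pq by (intro powr_mono2) auto
    thus ?thesis using pq Ip by (simp add: powr_powr)
  qed
  have "(\<lambda>m. I m) \<longlonglongrightarrow> (\<integral>x. norm (u x) powr p \<partial>?M)"
    unfolding I_def
  proof (rule integral_dominated_convergence[where w="\<lambda>x. norm (u x) powr p"])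
    show "AE x in ?M. (\<lambda>m. t m x) \<longlonglongrightarrow> norm (u x) powr p"
    proof (rule AE_I2)
      fix x
      obtain N :: nat where N: "norm (u x) \<le> real N" using real_arch_simple by blast
      have "\<forall>\<^sub>F m in sequentially. t m x = norm (u x) powr p"
        using eventually_ge_at_top[of N] by eventually_elim (use N in \<open>simp add: t_def\<close>)
      thus "(\<lambda>m. t m x) \<longlonglongrightarrow> norm (u x) powr p" by (simp add: tendsto_eventually)
    qed
  qed (auto simp: ui t_def)
  hence "(\<integral>x. norm (u x) powr p \<partial>?M) \<le> c powr p"
    using Ic by (intro LIMSEQ_le_const2) auto
  hence "Lr_norm \<Omega> p u powr p \<le> c powr p" using pq by (simp add: Lr_norm_powr)
  thus ?thesis using powr_less_mono2[of p c "Lr_norm \<Omega> p u"] c pq by force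
qed

section \<open>Completeness and uniform boundedness\<close>

text \<open>
  Completeness, with the explicit rate of convergence that the gliding hump argument below needs.
  Monotone convergence makes the series converge absolutely almost everywhere; elsewhere \<open>suminf\<close> takes an
  unspecified value, which the seminorm does not see. Fatou's lemma bounds the tails.
\<close>
lemma Lr_absolutely_convergent_series:
  assumes r: "r \<ge> 1" and f: "\<And>k. f k \<in> Lr \<Omega> r" and le: "\<And>k. Lr_norm \<Omega> r (f k) \<le> a k" and a: "summable a"
  shows "\<exists>s\<in>Lr \<Omega> r. \<forall>n. Lr_norm \<Omega> r (\<lambda>x. s x - (\<Sum>k<n. f k x)) \<le> (\<Sum>k. a (k + n))"
proof -
  let ?M = "lebesgue_on \<Omega>"
  have a0: "a k \<ge> 0" for k using le[of k] Lr_norm_nonneg[of \<Omega> r "f k"] by linarith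
  have [measurable]: "f k \<in> borel_measurable ?M" for k using f by (auto simp: Lr_def)
  let ?A = "\<Sum>k. a k"
  have A0: "?A \<ge> 0" using a a0 by (intro suminf_nonneg) auto
  define F where "F = (\<lambda>m x. \<Sum>k<m. complex_of_real (norm (f k x)))"
  have FL: "F m \<in> Lr \<Omega> r \<and> Lr_norm \<Omega> r (F m) \<le> ?A" for m
  proof -
    have n: "(\<lambda>x. complex_of_real (norm (f k x))) \<in> Lr \<Omega> r" "Lr_norm \<Omega> r (\<lambda>x. complex_of_real (norm (f k x))) = Lr_norm \<Omega> r (f k)" for k
      using f[of k] by (auto simp: Lr_def Lr_norm_def)
    have "F m \<in> Lr \<Omega> r \<and> Lr_norm \<Omega> r (F m) \<le> (\<Sum>k<m. Lr_norm \<Omega> r (f k))"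
      using Lr_sum[of r m "\<lambda>k x. complex_of_real (norm (f k x))" \<Omega>, OF r n(1)] unfolding F_def by (simp add: n)
    moreover have "(\<Sum>k<m. Lr_norm \<Omega> r (f k)) \<le> (\<Sum>k<m. a k)" by (intro sum_mono le)
    moreover have "(\<Sum>k<m. a k) \<le> ?A" using a a0 by (intro sum_le_suminf) auto
    ultimately show ?thesis by linarith
  qed
  have nF: "norm (F m x) = (\<Sum>k<m. norm (f k x))" for m x
    unfolding F_def by (simp add: sum_nonneg flip: of_real_sum)
  have "(\<integral>\<^sup>+x. (SUP m. ennreal (norm (F m x) powr r)) \<partial>?M) = (SUP m. \<integral>\<^sup>+x. ennreal (norm (F m x) powr r) \<partial>?M)"
  proof (rule nn_integral_monotone_convergence_SUP)
    show "incseq (\<lambda>m x. ennreal (norm (F m x) powr r))"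
      using r by (intro incseq_SucI le_funI ennreal_leI powr_mono2) (auto simp: nF sum_nonneg)
    show "(\<lambda>x. ennreal (norm (F m x) powr r)) \<in> borel_measurable ?M" for m
      unfolding nF by measurable
  qed
  also have "\<dots> \<le> ennreal (?A powr r)"
    using FL r by (intro SUP_least) (simp add: nn_integral_Lr ennreal_leI powr_mono2 Lr_norm_nonneg)
  finally have "(\<integral>\<^sup>+x. (SUP m. ennreal (norm (F m x) powr r)) \<partial>?M) \<noteq> \<infinity>"
    by (auto simp: top_unique)
  hence fin: "AE x in ?M. (SUP m. ennreal (norm (F m x) powr r)) \<noteq> \<infinity>"
    by (intro nn_integral_noteq_infinite) (simp_all add: nF)
  have summ: "AE x in ?M. summable (\<lambda>k. f k x)"
    using fin
  proof eventually_elim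
    case (elim x)
    then obtain B where B: "(SUP m. ennreal (norm (F m x) powr r)) = ennreal B" "B \<ge> 0"
      by (cases "SUP m. ennreal (norm (F m x) powr r)") auto
    have "(\<Sum>k<m. norm (f k x)) \<le> B powr (1/r)" for m
    proof -
      have "ennreal (norm (F m x) powr r) \<le> ennreal B" unfolding B(1)[symmetric] by (rule SUP_upper) simp
      hence "norm (F m x) powr r \<le> B" using B(2) by simp
      hence "(norm (F m x) powr r) powr (1/r) \<le> B powr (1/r)" using r by (intro powr_mono2) auto
      thus ?thesis using r by (simp add: powr_powr nF sum_nonneg)
    qed
    hence "summable (\<lambda>k. norm (f k x))" by (intro summableI_nonneg_bounded) auto
    thus "summable (\<lambda>k. f k x)" by (rule summable_norm_cancel)
  qed
  define s where "s = (\<lambda>x. \<Sum>k. f k x)"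
  have sm[measurable]: "s \<in> borel_measurable ?M" unfolding s_def by measurable
  have tail: "(\<lambda>x. s x - (\<Sum>k<n. f k x)) \<in> Lr \<Omega> r \<and> Lr_norm \<Omega> r (\<lambda>x. s x - (\<Sum>k<n. f k x)) \<le> (\<Sum>k. a (k + n))" for n
  proof -
    have b: "(\<lambda>x. \<Sum>k<m. f (k + n) x) \<in> Lr \<Omega> r \<and> Lr_norm \<Omega> r (\<lambda>x. \<Sum>k<m. f (k + n) x) \<le> (\<Sum>k. a (k + n))" for m
    proof -
      have "(\<Sum>k<m. Lr_norm \<Omega> r (f (k+n))) \<le> (\<Sum>k<m. a (k + n))" by (intro sum_mono le)
      moreover have "(\<Sum>k<m. a (k + n)) \<le> (\<Sum>k. a (k + n))" using a a0 by (intro sum_le_suminf) (auto simp: summable_iff_shift)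
      ultimately show ?thesis using Lr_sum[of r m "\<lambda>k. f (k + n)" \<Omega>, OF r f] by auto
    qed
    have lim: "AE x in ?M. (\<lambda>m. \<Sum>k<m. f (k + n) x) \<longlonglongrightarrow> s x - (\<Sum>k<n. f k x)"
      using summ
    proof eventually_elim
      case (elim x)
      hence "(\<lambda>k. f (k + n) x) sums (s x - (\<Sum>k<n. f k x))" unfolding s_def
        using sums_iff_shift[of "\<lambda>k. f k x" n "s x - (\<Sum>k<n. f k x)"] by (simp add: s_def summable_sums)
      thus ?case by (simp add: sums_def)
    qed
    have "(\<Sum>k. a (k + n)) \<ge> 0" using a a0 by (intro suminf_nonneg) (auto simp: summable_iff_shift)
    from Lr_Fatou[of r "\<lambda>m x. \<Sum>k<m. f (k + n) x" \<Omega>, OF _ _ _ this lim] show ?thesis using r b by auto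
  qed
  have "s \<in> Lr \<Omega> r" using tail[of 0] by simp
  thus ?thesis using tail by blast
qed

text \<open>
  Sokal's gliding hump proof, which works directly with functions and a seminorm. If the operator
  norms were unbounded, choose functionals of norm above $4^n$ and vectors in the unit ball on which
  they attain at least two thirds of their norm, and add these vectors up with coefficients
  $\pm 3^{-n}$. The sign is chosen so that the $n$-th functional is large on the $n$-th partial sum; the tail
  of the series is too small to undo this, so the functionals are unbounded at the limit.
\<close>
theorem Lr_uniform_boundedness:
  fixes L :: "'i \<Rightarrow> (complex ^ 'n \<Rightarrow> complex) \<Rightarrow> complex"
  assumes r: "r \<ge> 1"
    and add: "\<And>i f g. \<lbrakk>i \<in> I; f \<in> Lr \<Omega> r; g \<in> Lr \<Omega> r\<rbrakk> \<Longrightarrow> L i (\<lambda>x. f x + g x) = L i f + L i g"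
    and scale: "\<And>i c f. \<lbrakk>i \<in> I; f \<in> Lr \<Omega> r\<rbrakk> \<Longrightarrow> L i (\<lambda>x. c * f x) = c * L i f"
    and bdd: "\<And>i. i \<in> I \<Longrightarrow> \<exists>C. \<forall>f\<in>Lr \<Omega> r. norm (L i f) \<le> C * Lr_norm \<Omega> r f"
    and ptw: "\<And>f. f \<in> Lr \<Omega> r \<Longrightarrow> \<exists>C. \<forall>i\<in>I. norm (L i f) \<le> C"
  shows "\<exists>C. \<forall>i\<in>I. \<forall>f\<in>Lr \<Omega> r. norm (L i f) \<le> C * Lr_norm \<Omega> r f"
proof -
  define U where "U = {f \<in> Lr \<Omega> r. Lr_norm \<Omega> r f \<le> 1}"
  define N where "N = (\<lambda>i. SUP f\<in>U. norm (L i f))"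
  have U0: "(\<lambda>x. 0) \<in> U" by (simp add: U_def Lr_zero Lr_norm_zero)
  have bU: "bdd_above ((\<lambda>f. norm (L i f)) ` U)" if "i \<in> I" for i
  proof -
    obtain C where C: "\<forall>f\<in>Lr \<Omega> r. norm (L i f) \<le> C * Lr_norm \<Omega> r f" using bdd[OF \<open>i \<in> I\<close>] by blast
    have "norm (L i f) \<le> \<bar>C\<bar>" if "f \<in> U" for f
    proof -
      have "norm (L i f) \<le> C * Lr_norm \<Omega> r f" using C that by (auto simp: U_def)
      also have "\<dots> \<le> \<bar>C\<bar> * 1" using that by (intro mult_mono) (auto simp: U_def Lr_norm_nonneg)
      finally show ?thesis by simp
    qed
    thus ?thesis by (auto intro!: bdd_aboveI2)
  qed
  have N0: "N i \<ge> 0" if "i \<in> I" for i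
    unfolding N_def by (rule cSUP_upper2[OF bU[OF that] U0]) simp
  have NL: "norm (L i f) \<le> N i * Lr_norm \<Omega> r f" if i: "i \<in> I" and f: "f \<in> Lr \<Omega> r" for i f
  proof (cases "Lr_norm \<Omega> r f = 0")
    case True
    with bdd[OF i] f show ?thesis by force
  next
    case False
    define c where "c = Lr_norm \<Omega> r f"
    have c: "c > 0" using False Lr_norm_nonneg[of \<Omega> r f] by (simp add: c_def)
    have "(\<lambda>x. complex_of_real (1/c) * f x) \<in> U"
      using c r Lr_cmult[OF f, of "complex_of_real (1/c)"] Lr_norm_cmult[of r \<Omega> "complex_of_real (1/c)" f]
      by (simp add: U_def norm_divide c_def)
    hence "norm (L i (\<lambda>x. complex_of_real (1/c) * f x)) \<le> N i"
      unfolding N_def by (rule cSUP_upper[OF _ bU[OF i]])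
    hence "norm (complex_of_real (1/c) * L i f) \<le> N i" by (simp only: scale[OF i f])
    thus ?thesis using c by (simp add: norm_divide norm_mult field_simps flip: c_def)
  qed
  have "\<exists>C. \<forall>i\<in>I. N i \<le> C"
  proof (rule ccontr)
    assume neg: "\<not> ?thesis"
    have ex: "\<exists>i f. i \<in> I \<and> f \<in> U \<and> N i > 4 ^ n \<and> norm (L i f) \<ge> 2/3 * N i" for n :: nat
    proof -
      obtain i where i: "i \<in> I" "N i > 4 ^ n" using neg by (meson not_le)
      have "N i > 0" using i(2) by (rule less_trans[rotated]) simp
      hence "2/3 * N i < N i" by simp
      hence "2/3 * N i < (SUP f\<in>U. norm (L i f))" by (simp only: N_def)
      then obtain f where "f \<in> U" "norm (L i f) > 2/3 * N i"
        using less_cSUP_iff[OF _ bU[OF i(1)], of "2/3 * N i"] U0 by blast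
      thus ?thesis using i by force
    qed
    then obtain i f where if_: "\<And>n. i n \<in> I" "\<And>n. f n \<in> U" "\<And>n :: nat. N (i n) > 4 ^ n"
        "\<And>n. norm (L (i n) (f n)) \<ge> 2/3 * N (i n)" by metis
    have fL: "f n \<in> Lr \<Omega> r" "Lr_norm \<Omega> r (f n) \<le> 1" for n using if_(2)[of n] by (auto simp: U_def)
    define a where "a = (\<lambda>n::nat. (1/3::real) ^ n)"
    have a0: "a n \<ge> 0" for n by (simp add: a_def)
    have step: "\<exists>\<epsilon>::complex. norm \<epsilon> = 1 \<and> norm (L (i n) (\<lambda>y. x y + \<epsilon> * of_real (a n) * f n y)) \<ge> a n * norm (L (i n) (f n))"
      if x: "x \<in> Lr \<Omega> r" for x n
    proof -
      let ?w = "of_real (a n) * L (i n) (f n)"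
      have e: "L (i n) (\<lambda>y. x y + \<epsilon> * of_real (a n) * f n y) = L (i n) x + \<epsilon> * ?w" for \<epsilon>
      proof -
        have "L (i n) (\<lambda>y. x y + \<epsilon> * of_real (a n) * f n y) = L (i n) x + L (i n) (\<lambda>y. \<epsilon> * of_real (a n) * f n y)"
          by (rule add[OF if_(1) x Lr_cmult[OF fL(1)]])
        also have "L (i n) (\<lambda>y. \<epsilon> * of_real (a n) * f n y) = \<epsilon> * of_real (a n) * L (i n) (f n)"
          by (rule scale[OF if_(1) fL(1)])
        finally show ?thesis by (simp only: mult.assoc)
      qed
      \<comment> \<open>one of \<open>\<bar>v + w\<bar>\<close> and \<open>\<bar>v - w\<bar>\<close> is at least \<open>\<bar>w\<bar>\<close>\<close>
      have "2 * norm ?w = norm ((L (i n) x + ?w) - (L (i n) x - ?w))" by (simp add: norm_mult flip: mult_2)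
      also have "\<dots> \<le> norm (L (i n) x + ?w) + norm (L (i n) x - ?w)" by (rule norm_triangle_ineq4)
      finally have "norm ?w \<le> norm (L (i n) x + 1 * ?w) \<or> norm ?w \<le> norm (L (i n) x + (-1) * ?w)" by auto
      moreover have "a n \<ge> 0" by (simp add: a_def)
      hence "norm ?w = a n * norm (L (i n) (f n))" by (simp add: norm_mult)
      ultimately show ?thesis unfolding e by (metis norm_minus_cancel norm_one)
    qed
    define pick where "pick = (\<lambda>n x. SOME \<epsilon>::complex. norm \<epsilon> = 1 \<and> norm (L (i n) (\<lambda>y. x y + \<epsilon> * of_real (a n) * f n y)) \<ge> a n * norm (L (i n) (f n)))"
    have pick: "norm (pick n x) = 1 \<and> norm (L (i n) (\<lambda>y. x y + pick n x * of_real (a n) * f n y)) \<ge> a n * norm (L (i n) (f n))"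
      if "x \<in> Lr \<Omega> r" for n x
      unfolding pick_def using step[OF that] by (rule someI_ex)
    define X where "X = rec_nat (\<lambda>y. 0) (\<lambda>n x y. x y + pick n x * of_real (a n) * f n y)"
    have X0: "X 0 = (\<lambda>y. 0)" and XS: "X (Suc n) = (\<lambda>y. X n y + pick n (X n) * of_real (a n) * f n y)" for n
      by (simp_all add: X_def)
    have XL: "X n \<in> Lr \<Omega> r" for n
      by (induction n) (auto simp: X0 XS Lr_zero intro!: Lr_add r Lr_cmult fL(1))
    define g where "g = (\<lambda>n y. pick n (X n) * of_real (a n) * f n y)"
    have gL: "g n \<in> Lr \<Omega> r" for n unfolding g_def by (intro Lr_cmult fL(1))
    have gn: "Lr_norm \<Omega> r (g n) \<le> a n" for n
      unfolding g_def using r fL(2)[of n] pick[OF XL, of n n]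
      by (subst Lr_norm_cmult) (auto simp: norm_mult a0 intro!: mult_left_le)
    have Xg: "X n = (\<lambda>y. \<Sum>k<n. g k y)" for n
      by (induction n) (auto simp: X0 XS g_def)
    have sa: "summable a" unfolding a_def by (rule summable_geometric) simp
    obtain s where s: "s \<in> Lr \<Omega> r" "\<And>n. Lr_norm \<Omega> r (\<lambda>y. s y - X n y) \<le> (\<Sum>k. a (k + n))"
      using Lr_absolutely_convergent_series[OF r gL gn sa] unfolding Xg by blast
    have tail: "(\<Sum>k. a (k + Suc n)) = a n / 2" for n
    proof -
      have "(\<lambda>k. (1/3::real) ^ k * (1/3) ^ Suc n) sums (1 / (1 - 1/3) * (1/3) ^ Suc n)"
        by (intro sums_mult2 geometric_sums) simp
      hence "(\<lambda>k. a (k + Suc n)) sums (1 / (1 - 1/3) * (1/3) ^ Suc n)"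
        unfolding a_def power_add .
      thus ?thesis by (simp add: sums_iff a_def)
    qed
    \<comment> \<open>\<open>2/3\<close> from the choice of the unit vector, minus \<open>1/2\<close> from the tail\<close>
    have low: "norm (L (i n) s) \<ge> a n * N (i n) / 6" for n
    proof -
      have d: "(\<lambda>y. s y - X (Suc n) y) \<in> Lr \<Omega> r" by (rule Lr_diff[OF r s(1) XL])
      have "L (i n) s = L (i n) (\<lambda>y. X (Suc n) y + (s y - X (Suc n) y))" by simp
      also have "\<dots> = L (i n) (X (Suc n)) + L (i n) (\<lambda>y. s y - X (Suc n) y)"
        by (rule add[OF if_(1) XL d])
      finally have "norm (L (i n) s) \<ge> norm (L (i n) (X (Suc n))) - norm (L (i n) (\<lambda>y. s y - X (Suc n) y))"
        by (metis add_diff_cancel_right' norm_triangle_ineq2 norm_minus_commute add_diff_cancel_left' norm_diff_ineq)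
      moreover have "norm (L (i n) (X (Suc n))) \<ge> a n * (2/3 * N (i n))"
      proof -
        have "a n * (2/3 * N (i n)) \<le> a n * norm (L (i n) (f n))" using if_(4)[of n] by (intro mult_left_mono) (auto simp: a_def)
        also have "\<dots> \<le> norm (L (i n) (X (Suc n)))" using pick[OF XL, of n n] by (simp add: XS)
        finally show ?thesis .
      qed
      moreover have "norm (L (i n) (\<lambda>y. s y - X (Suc n) y)) \<le> N (i n) * (a n / 2)"
        using NL[OF if_(1) d, of n] s(2)[of "Suc n"] N0[OF if_(1), of n] unfolding tail
        by (meson mult_left_mono order_trans)
      ultimately show ?thesis by (simp add: algebra_simps)
    qed
    obtain C where C: "\<And>j. j \<in> I \<Longrightarrow> norm (L j s) \<le> C" using ptw[OF s(1)] by blast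
    have "(4/3) ^ n \<le> 6 * C" for n :: nat
    proof -
      have "(4/3::real) ^ n = a n * 4 ^ n" by (simp add: a_def flip: power_mult_distrib)
      also have "\<dots> \<le> a n * N (i n)" using if_(3)[of n] by (intro mult_left_mono) (auto simp: a_def)
      also have "\<dots> \<le> 6 * C" using low[of n] C[OF if_(1), of n] by simp
      finally show ?thesis .
    qed
    moreover obtain n where "6 * C < (4/3::real) ^ n" using real_arch_pow[of "4/3" "6 * C"] by auto
    ultimately show False by (meson not_le)
  qed
  then obtain C where C: "\<forall>i\<in>I. N i \<le> C" by blast
  have "norm (L i f) \<le> C * Lr_norm \<Omega> r f" if "i \<in> I" "f \<in> Lr \<Omega> r" for i f
    using NL[OF that] C that by (meson Lr_norm_nonneg mult_right_mono order_trans)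
  thus ?thesis by blast
qed

section \<open>Rotation invariance of Lebesgue measure\<close>

text \<open>
  Any Euclidean space is measure-isomorphic to a space of column vectors. It
  carries the change of variables formula for column vectors over to other Euclidean spaces.
\<close>
lemma lborel_distr_coordinates:
  fixes b :: "'m::finite \<Rightarrow> 'a::euclidean_space"
  assumes b: "bij_betw b UNIV Basis"
  shows "distr (lborel :: (real ^ 'm::_) measure) borel (\<lambda>x. \<Sum>i\<in>UNIV. (x $ i) *\<^sub>R b i) = lborel"
proof (rule lborel_eqI[symmetric])
  let ?T = "\<lambda>x :: real ^ 'm::_. \<Sum>i\<in>UNIV. (x $ i) *\<^sub>R b i"
  have bB: "b i \<in> Basis" for i using b by (auto simp: bij_betw_def)
  have bi: "b i = b j \<longleftrightarrow> i = j" for i j using b by (auto simp: bij_betw_def inj_on_def)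
  have T: "?T x \<bullet> b j = x $ j" for x j
    by (simp add: inner_sum_left inner_Basis bB bi if_distrib [of "\<lambda>u. _ * u"] cong: if_cong)
  have Bas: "Basis = range b" using b by (auto simp: bij_betw_def)
  fix l u :: 'a
  assume le: "\<And>c. c \<in> Basis \<Longrightarrow> l \<bullet> c \<le> u \<bullet> c"
  have vim: "?T -` box l u = box (\<chi> i. l \<bullet> b i) (\<chi> i. u \<bullet> b i)"
  proof -
    have "?T x \<in> box l u \<longleftrightarrow> (\<forall>i. l \<bullet> b i < x $ i \<and> x $ i < u \<bullet> b i)" for x
      unfolding mem_box Bas by (simp add: T)
    thus ?thesis by (auto simp: mem_box_cart)
  qed
  have meas: "?T \<in> borel_measurable lborel" by measurable
  have "emeasure (distr lborel borel ?T) (box l u) = emeasure lborel (box (\<chi> i. l \<bullet> b i) (\<chi> i. u \<bullet> b i) :: (real^'m::_) set)"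
    using meas by (subst emeasure_distr) (auto simp: vim)
  also have "\<dots> = (\<Prod>c\<in>(Basis :: (real^'m::_) set). ((\<chi> i. u \<bullet> b i) - (\<chi> i. l \<bullet> b i)) \<bullet> c)"
    using le by (intro emeasure_lborel_box) (auto simp: Basis_vec_def inner_axis bB)
  also have "(\<Prod>c\<in>(Basis :: (real^'m::_) set). ((\<chi> i. u \<bullet> b i) - (\<chi> i. l \<bullet> b i)) \<bullet> c)
      = (\<Prod>i\<in>(UNIV :: 'm set). (u - l) \<bullet> b i)"
  proof -
    have e: "(Basis :: (real^'m::_) set) = range (\<lambda>i. axis i 1)" by (auto simp: Basis_vec_def)
    have inj: "inj (\<lambda>i::'m. axis i (1::real))" by (auto simp: inj_on_def axis_eq_axis)
    show ?thesis unfolding e by (subst prod.reindex[OF inj]) (simp add: inner_axis inner_diff_left)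
  qed
  also have "\<dots> = (\<Prod>c\<in>Basis. (u - l) \<bullet> c)"
    using prod.reindex_bij_betw[OF b, of "\<lambda>c. (u-l) \<bullet> c"] by simp
  finally show "emeasure (distr lborel borel ?T) (box l u) = (\<Prod>c\<in>Basis. (u - l) \<bullet> c)" by simp
qed simp

lemma lborel_distr_orthogonal_cart:
  fixes f :: "real^'m::{finite,wellorder} \<Rightarrow> real^'m::_"
  assumes f: "orthogonal_transformation f"
  shows "distr lborel borel f = lborel"
proof (rule lborel_eqI[symmetric])
  have lf: "linear f" using f by (rule orthogonal_transformation_linear)
  hence meas: "f \<in> borel_measurable borel"
    by (intro borel_measurable_continuous_onI linear_continuous_on) (simp add: linear_linear)
  have bf: "bij f" using f by (rule orthogonal_transformation_bij)
  have invf: "orthogonal_transformation (inv f)" using f by (rule orthogonal_transformation_inv)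
  fix l u :: "real^'m::_"
  assume le: "\<And>c. c \<in> Basis \<Longrightarrow> l \<bullet> c \<le> u \<bullet> c"
  have "f -` box l u = inv f ` box l u" using bf by (simp add: bij_vimage_eq_inv_image)
  moreover have "inv f ` box l u \<in> lmeasurable" "measure lebesgue (inv f ` box l u) = measure lebesgue (box l u)"
    using measurable_orthogonal_image[OF invf, of "box l u"] measure_orthogonal_image[OF invf, of "box l u"] by auto
  moreover have vb: "f -` box l u \<in> sets lborel" using measurable_sets_borel[OF meas, of "box l u"] by simp
  ultimately have "emeasure lborel (f -` box l u) = emeasure lborel (box l u)"
    using vb emeasure_lborel_box_finite[of l u]
    by (simp add: fmeasurable_def emeasure_eq_ennreal_measure measure_completion less_top)
  thus "emeasure (distr lborel borel f) (box l u) = (\<Prod>c\<in>Basis. (u - l) \<bullet> c)"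
    using meas le by (subst emeasure_distr) (auto simp: emeasure_lborel_box_eq)
qed simp

text \<open>
  The function \<open>b\<close> only supplies a well-ordered index type of the right size, through which the map is
  conjugated to column vectors.
\<close>
lemma lborel_distr_orthogonal:
  fixes f :: "'a::euclidean_space \<Rightarrow> 'a" and b :: "'m::{finite,wellorder} \<Rightarrow> 'a"
  assumes f: "orthogonal_transformation f" and b: "bij_betw b UNIV Basis"
  shows "distr lborel borel f = lborel"
proof -
  have bB: "b i \<in> Basis" for i using b by (auto simp: bij_betw_def)
  have bi: "b i = b j \<longleftrightarrow> i = j" for i j using b by (auto simp: bij_betw_def inj_on_def)
  define T where "T = (\<lambda>x :: real ^ 'm::_. \<Sum>i\<in>UNIV. (x $ i) *\<^sub>R b i)"
  define S where "S = (\<lambda>y. (\<chi> i. y \<bullet> b i) :: real ^ 'm::_)"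
  have T: "T x \<bullet> b j = x $ j" for x j unfolding T_def
    by (simp add: inner_sum_left inner_Basis bB bi if_distrib [of "\<lambda>u. _ * u"] cong: if_cong)
  have TS: "T (S y) = y" for y
  proof -
    have "T (S y) = (\<Sum>i\<in>UNIV. (y \<bullet> b i) *\<^sub>R b i)" by (simp add: T_def S_def)
    also have "\<dots> = (\<Sum>c\<in>Basis. (y \<bullet> c) *\<^sub>R c)"
      using sum.reindex_bij_betw[OF b, of "\<lambda>c. (y \<bullet> c) *\<^sub>R c"] by simp
    finally show ?thesis by (simp add: euclidean_representation)
  qed
  have linT: "linear T" unfolding T_def by (rule linearI) (simp_all add: scaleR_add_left sum.distrib scaleR_sum_right)
  have linS: "linear S" unfolding S_def by (rule linearI) (simp_all add: vec_eq_iff inner_add_left)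
  have inT: "T x \<bullet> T y = x \<bullet> y" for x y
  proof -
    have "T x \<bullet> T y = (\<Sum>i\<in>UNIV. (x $ i) * (b i \<bullet> T y))" unfolding T_def[of] by (simp add: inner_sum_left)
    thus ?thesis by (simp add: T inner_commute[of "b _"] inner_vec_def)
  qed
  have lf: "linear f" using f by (rule orthogonal_transformation_linear)
  have inS: "S x \<bullet> S y = x \<bullet> y" for x y using inT[of "S x" "S y"] TS by simp
  have "orthogonal_transformation (S \<circ> f \<circ> T)"
    unfolding orthogonal_transformation_def using linT linS lf f
    by (auto intro!: linear_compose simp: inS inT orthogonal_transformation_def)
  hence inv: "distr lborel borel (S \<circ> f \<circ> T) = lborel" by (rule lborel_distr_orthogonal_cart)
  have mT: "T \<in> borel_measurable borel" and mS: "S \<in> borel_measurable borel" and mf: "f \<in> borel_measurable borel"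
    using linT linS lf by (auto intro!: borel_measurable_continuous_onI linear_continuous_on simp: linear_linear)
  have dT: "distr lborel borel T = lborel" unfolding T_def by (rule lborel_distr_coordinates[OF b])
  have "distr lborel borel f = distr (distr lborel borel T) borel f" by (simp add: dT)
  also have "\<dots> = distr lborel borel (f \<circ> T)" using mT mf by (simp add: distr_distr)
  also have "f \<circ> T = T \<circ> (S \<circ> f \<circ> T)" by (auto simp: TS)
  also have "distr lborel borel (T \<circ> (S \<circ> f \<circ> T)) = distr (distr lborel borel (S \<circ> f \<circ> T)) borel T"
    using mT mf mS by (intro distr_distr[symmetric]) (auto intro!: measurable_comp)
  also have "\<dots> = lborel" by (simp add: inv dT)
  finally show ?thesis .
qed

text \<open>
  Multiplication by a unimodular scalar is a real orthogonal transformation. The type \<open>'n bit0\<close>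
  is a well-ordered type with twice as many elements as \<open>'n\<close>, hence as many as the real dimension.
\<close>
lemma lborel_distr_unimodular:
  fixes c :: complex
  assumes "norm c = 1"
  shows "distr (lborel :: (complex ^ 'n) measure) borel (\<lambda>w. c *s w) = lborel"
proof -
  have "linear (\<lambda>w :: complex ^ 'n. c *s w)"
    by (rule linearI) (simp_all add: vec_eq_iff algebra_simps)
  moreover have "norm (c *s w) = norm w" for w :: "complex ^ 'n"
    using assms by (simp add: norm_vec_def L2_set_def norm_mult)
  ultimately have o: "orthogonal_transformation (\<lambda>w :: complex ^ 'n. c *s w)"
    by (simp add: orthogonal_transformation)
  have "card (UNIV :: 'n bit0 set) = card (Basis :: (complex ^ 'n) set)"
    by simp
  then obtain b :: "'n bit0 \<Rightarrow> complex ^ 'n" where "bij_betw b UNIV Basis"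
    using finite_same_card_bij[of "UNIV :: 'n bit0 set" "Basis :: (complex ^ 'n) set"] by auto
  from lborel_distr_orthogonal[OF o this] show ?thesis .
qed

section \<open>Holomorphic functions of several variables\<close>

lemma complex_linear_iff:
  "Vector_Spaces.linear (*s) (*) (D :: complex ^ 'n \<Rightarrow> complex) \<longleftrightarrow>
     (\<forall>x y. D (x + y) = D x + D y) \<and> (\<forall>c x. D (c *s x) = c * D x)"
  using vec.vector_space_axioms[where 'a=complex and 'b='n] vector_space_over_itself.vector_space_axioms[where 'a=complex]
  by (auto simp: Vector_Spaces.linear_iff)

lemma holomorphic_sv_add:
  assumes "holomorphic_sv f \<Omega>" "holomorphic_sv g \<Omega>"
  shows "holomorphic_sv (\<lambda>x. f x + g x) \<Omega>"
  unfolding holomorphic_sv_def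
proof
  fix z assume "z \<in> \<Omega>"
  with assms obtain D E where "(f has_derivative D) (at z)" "Vector_Spaces.linear (*s) (*) D"
    "(g has_derivative E) (at z)" "Vector_Spaces.linear (*s) (*) E"
    unfolding holomorphic_sv_def by metis
  thus "\<exists>D. ((\<lambda>x. f x + g x) has_derivative D) (at z) \<and> Vector_Spaces.linear (*s) (*) D"
    by (intro exI[of _ "\<lambda>h. D h + E h"]) (auto simp: complex_linear_iff algebra_simps intro!: has_derivative_add)
qed

lemma holomorphic_sv_cmult:
  assumes "holomorphic_sv f \<Omega>"
  shows "holomorphic_sv (\<lambda>x. c * f x) \<Omega>"
  unfolding holomorphic_sv_def
proof
  fix z assume "z \<in> \<Omega>"
  with assms obtain D where "(f has_derivative D) (at z)" "Vector_Spaces.linear (*s) (*) D"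
    unfolding holomorphic_sv_def by metis
  thus "\<exists>D. ((\<lambda>x. c * f x) has_derivative D) (at z) \<and> Vector_Spaces.linear (*s) (*) D"
    by (intro exI[of _ "\<lambda>h. c * D h"]) (auto simp: complex_linear_iff algebra_simps intro!: has_derivative_mult_right)
qed

lemma holomorphic_sv_subset:
  "holomorphic_sv f \<Omega> \<Longrightarrow> S \<subseteq> \<Omega> \<Longrightarrow> holomorphic_sv f S"
  by (auto simp: holomorphic_sv_def)

lemma holomorphic_sv_continuous_on:
  assumes "holomorphic_sv f \<Omega>"
  shows "continuous_on \<Omega> f"
  using assms unfolding holomorphic_sv_def
  by (intro continuous_at_imp_continuous_on ballI) (blast intro: has_derivative_continuous)

lemma holomorphic_sv_measurable:
  assumes "holomorphic_sv f \<Omega>" "open \<Omega>"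
  shows "f \<in> borel_measurable (lebesgue_on \<Omega>)"
  using holomorphic_sv_continuous_on[OF assms(1)] assms(2)
  by (intro continuous_imp_measurable_on_sets_lebesgue) auto

lemma norm_cscale: "norm (c *s (w :: complex ^ 'n)) = norm c * norm w"
  by (simp add: norm_vec_def L2_set_def norm_mult power_mult_distrib real_sqrt_mult flip: sum_distrib_left)

text \<open>
  Restriction to complex lines reduces Cauchy's theorem in several variables to one variable.
\<close>
lemma holomorphic_sv_complex_line:
  fixes w :: "complex ^ 'n"
  assumes D: "(f has_derivative D) (at (z + \<zeta> *s w))" "Vector_Spaces.linear (*s) (*) D"
  shows "((\<lambda>\<zeta>. f (z + \<zeta> *s w)) has_field_derivative D w) (at \<zeta>)"
proof -
  have "linear (\<lambda>\<zeta>::complex. \<zeta> *s w)"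
    by (rule linearI) (simp_all add: vec_eq_iff algebra_simps)
  hence bl: "bounded_linear (\<lambda>\<zeta>::complex. \<zeta> *s w)" by (simp add: linear_conv_bounded_linear)
  have "((\<lambda>\<zeta>. z + \<zeta> *s w) has_derivative (\<lambda>h. h *s w)) (at \<zeta>)"
    using has_derivative_add[OF has_derivative_const bounded_linear_imp_has_derivative[OF bl]] by simp
  from has_derivative_compose[OF this D(1)]
  have "((\<lambda>\<zeta>. f (z + \<zeta> *s w)) has_derivative (\<lambda>h. D (h *s w))) (at \<zeta>)" .
  moreover have "(\<lambda>h. D (h *s w)) = (*) (D w)" using D(2) by (auto simp: complex_linear_iff mult.commute)
  ultimately show ?thesis by (simp add: has_field_derivative_def)
qed

lemma holomorphic_on_complex_line:
  fixes w :: "complex ^ 'n"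
  assumes "holomorphic_sv f \<Omega>"
  shows "(\<lambda>\<zeta>. f (z + \<zeta> *s w)) holomorphic_on {\<zeta>. z + \<zeta> *s w \<in> \<Omega>}"
  unfolding holomorphic_on_def
proof
  fix \<zeta> assume "\<zeta> \<in> {\<zeta>. z + \<zeta> *s w \<in> \<Omega>}"
  with assms obtain D where "(f has_derivative D) (at (z + \<zeta> *s w))" "Vector_Spaces.linear (*s) (*) D"
    unfolding holomorphic_sv_def by blast
  from holomorphic_sv_complex_line[OF this]
  show "(\<lambda>\<zeta>. f (z + \<zeta> *s w)) field_differentiable at \<zeta> within {\<zeta>. z + \<zeta> *s w \<in> \<Omega>}"
    using field_differentiable_at_within field_differentiable_def by blast
qed

text \<open>
  Cauchy's inequality on the disc of radius \<open>s / \<bar>h\<bar>\<close> in the complex line through \<open>x\<close> in direction \<open>h\<close>.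
\<close>
lemma holomorphic_sv_Cauchy_estimate:
  fixes f :: "complex ^ 'n \<Rightarrow> complex"
  assumes hol: "holomorphic_sv f \<Omega>" and sub: "cball x s \<subseteq> \<Omega>" and s: "s > 0"
    and M: "\<And>y. y \<in> cball x s \<Longrightarrow> norm (f y) \<le> M"
    and D: "(f has_derivative D) (at x)" "Vector_Spaces.linear (*s) (*) D"
  shows "norm (D h) \<le> M / s * norm h"
proof (cases "h = 0")
  case True
  have "D 0 = 0" using D(2) by (metis add_cancel_right_right complex_linear_iff)
  thus ?thesis using True by simp
next
  case False
  define \<rho> where "\<rho> = s / norm h"
  have \<rho>: "\<rho> > 0" using s False by (simp add: \<rho>_def)
  define g where "g = (\<lambda>\<zeta>. f (x + \<zeta> *s h))"
  have inb: "x + \<zeta> *s h \<in> cball x s" if "norm \<zeta> \<le> \<rho>" for \<zeta>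
    using that False by (simp add: dist_norm norm_cscale \<rho>_def field_simps)
  have hg: "g holomorphic_on cball 0 \<rho>"
    using holomorphic_on_complex_line[OF hol, of x h] unfolding g_def
    by (rule holomorphic_on_subset) (use inb sub in force)
  have "norm ((deriv ^^ 1) g 0) \<le> fact 1 * M / \<rho> ^ 1"
  proof (rule Cauchy_inequality)
    show "g holomorphic_on ball 0 \<rho>" using hg by (rule holomorphic_on_subset) auto
    show "continuous_on (cball 0 \<rho>) g" using hg by (rule holomorphic_on_imp_continuous_on)
    show "norm (g \<zeta>) \<le> M" if "norm (0 - \<zeta>) = \<rho>" for \<zeta>
      using M[OF inb, of \<zeta>] that by (simp add: g_def)
  qed (rule \<rho>)
  moreover have "deriv g 0 = D h" unfolding g_def
    by (rule DERIV_imp_deriv, rule holomorphic_sv_complex_line) (use D in auto)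
  ultimately show ?thesis using False s by (simp add: \<rho>_def)
qed

text \<open>
  Weierstrass' theorem. By the Cauchy estimate for differences, the derivatives are uniformly Cauchy
  on a smaller ball; their limit is complex linear and is the derivative of the limit function.
\<close>
theorem holomorphic_sv_uniform_limit:
  fixes f :: "nat \<Rightarrow> complex ^ 'n \<Rightarrow> complex"
  assumes hol: "\<And>n. holomorphic_sv (f n) \<Omega>"
    and lim: "\<And>z. z \<in> \<Omega> \<Longrightarrow> \<exists>r>0. ball z r \<subseteq> \<Omega> \<and> uniform_limit (ball z r) f g sequentially"
  shows "holomorphic_sv g \<Omega>"
  unfolding holomorphic_sv_def
proof
  fix z assume z: "z \<in> \<Omega>"
  then obtain r where r: "r > 0" "ball z r \<subseteq> \<Omega>" and ul: "uniform_limit (ball z r) f g sequentially"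
    using lim by blast
  \<comment> \<open>closed balls of radius \<open>s\<close> around points within \<open>s\<close> of \<open>z\<close> stay inside \<open>ball z r\<close>\<close>
  define s where "s = r / 3"
  have s: "s > 0" using r by (simp add: s_def)
  let ?S = "ball z s"
  have cb: "cball x s \<subseteq> ball z r" if "x \<in> ?S" for x
  proof
    fix y assume "y \<in> cball x s"
    thus "y \<in> ball z r" using that s dist_triangle[of z y x] by (simp add: s_def)
  qed
  have "\<exists>D. \<forall>n. \<forall>x\<in>?S. (f n has_derivative D n x) (at x) \<and> Vector_Spaces.linear (*s) (*) (D n x)"
  proof -
    have "\<forall>n. \<forall>x\<in>?S. \<exists>D. (f n has_derivative D) (at x) \<and> Vector_Spaces.linear (*s) (*) D"
    proof (intro allI ballI)
      fix n x assume "x \<in> ?S"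
      hence "x \<in> \<Omega>" using cb[of x] s r by (meson centre_in_cball less_imp_le subsetD)
      thus "\<exists>D. (f n has_derivative D) (at x) \<and> Vector_Spaces.linear (*s) (*) D"
        using hol by (auto simp: holomorphic_sv_def)
    qed
    thus ?thesis by metis
  qed
  then obtain D where D: "\<And>n x. x \<in> ?S \<Longrightarrow> (f n has_derivative D n x) (at x)"
    "\<And>n x. x \<in> ?S \<Longrightarrow> Vector_Spaces.linear (*s) (*) (D n x)" by blast
  have est: "\<exists>N. \<forall>m\<ge>N. \<forall>n\<ge>N. \<forall>x\<in>?S. \<forall>h. norm (D m x h - D n x h) \<le> e * norm h" if "e > 0" for e
  proof -
    have "\<forall>\<^sub>F n in sequentially. \<forall>y\<in>ball z r. dist (f n y) (g y) < e * s / 2"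
      using uniform_limitD[OF ul, of "e * s / 2"] that s by simp
    then obtain N where N: "\<And>n y. n \<ge> N \<Longrightarrow> y \<in> ball z r \<Longrightarrow> dist (f n y) (g y) < e * s / 2"
      unfolding eventually_sequentially by blast
    have "norm (D m x h - D n x h) \<le> e * norm h" if "m \<ge> N" "n \<ge> N" "x \<in> ?S" for m n x h
    proof -
      have "norm ((\<lambda>h. D m x h - D n x h) h) \<le> (e * s) / s * norm h"
      proof (rule holomorphic_sv_Cauchy_estimate)
        show "holomorphic_sv (\<lambda>y. f m y - f n y) (ball z r)"
          using holomorphic_sv_add[OF hol holomorphic_sv_cmult[OF hol, of "-1"], of m n] r(2)
          by (auto intro: holomorphic_sv_subset)
        show "cball x s \<subseteq> ball z r" by (rule cb) fact
        show "norm (f m y - f n y) \<le> e * s" if "y \<in> cball x s" for y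
        proof -
          have "y \<in> ball z r" using cb[OF \<open>x \<in> ?S\<close>] that by blast
          from N[OF \<open>m \<ge> N\<close> this] N[OF \<open>n \<ge> N\<close> this]
          show ?thesis using dist_triangle2[of "f m y" "f n y" "g y"] by (simp add: dist_norm)
        qed
        show "((\<lambda>y. f m y - f n y) has_derivative (\<lambda>h. D m x h - D n x h)) (at x)"
          using D(1)[OF \<open>x \<in> ?S\<close>] by (intro has_derivative_diff)
        show "Vector_Spaces.linear (*s) (*) (\<lambda>h. D m x h - D n x h)"
          using D(2)[OF \<open>x \<in> ?S\<close>] by (simp add: complex_linear_iff algebra_simps)
      qed (rule s)
      thus ?thesis using s by simp
    qed
    thus ?thesis by blast
  qed
  define D' where "D' = (\<lambda>x h. lim (\<lambda>n. D n x h))"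
  have conv: "(\<lambda>n. D n x h) \<longlonglongrightarrow> D' x h" if x: "x \<in> ?S" for x h
  proof -
    have "Cauchy (\<lambda>n. D n x h)"
    proof (rule metric_CauchyI)
      fix e :: real assume e: "e > 0"
      define e' where "e' = e / (norm h + 1)"
      have pos: "norm h + 1 > 0" by (simp add: add_nonneg_pos)
      hence e': "e' > 0" using e by (simp add: e'_def)
      hence "e' * norm h < e' * (norm h + 1)" by simp
      hence lt: "e' * norm h < e" using pos by (simp add: e'_def)
      obtain N where "\<forall>m\<ge>N. \<forall>n\<ge>N. norm (D m x h - D n x h) \<le> e' * norm h"
        using est[OF e'] x by blast
      thus "\<exists>N. \<forall>m\<ge>N. \<forall>n\<ge>N. dist (D m x h) (D n x h) < e"
        using lt by (force simp: dist_norm)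
    qed
    thus ?thesis unfolding D'_def by (simp add: Cauchy_convergent_iff convergent_LIMSEQ_iff)
  qed
  have lin: "Vector_Spaces.linear (*s) (*) (D' x)" if x: "x \<in> ?S" for x
    unfolding complex_linear_iff
  proof (intro conjI allI)
    fix h k c
    have "D n x (h + k) = D n x h + D n x k" "D n x (c *s h) = c * D n x h" for n
      using D(2)[OF x, of n] by (auto simp: complex_linear_iff)
    hence "(\<lambda>n. D n x (h + k)) \<longlonglongrightarrow> D' x h + D' x k" "(\<lambda>n. D n x (c *s h)) \<longlonglongrightarrow> c * D' x h"
      by (auto intro!: tendsto_intros conv x)
    thus "D' x (h + k) = D' x h + D' x k" "D' x (c *s h) = c * D' x h"
      using conv[OF x] LIMSEQ_unique by blast+
  qed
  have zS: "z \<in> ?S" using s by simp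
  have "\<exists>G. \<forall>x\<in>?S. (\<lambda>n. f n x) \<longlonglongrightarrow> G x \<and> (G has_derivative D' x) (at x within ?S)"
  proof (rule has_derivative_sequence[OF _ _ _ zS])
    show "convex ?S" by simp
    show "(f n has_derivative D n x) (at x within ?S)" if "x \<in> ?S" for n x
      using D(1)[OF that] by (rule has_derivative_at_withinI)
    show "\<forall>\<^sub>F n in sequentially. \<forall>x\<in>?S. \<forall>h. norm (D n x h - D' x h) \<le> e * norm h" if e: "e > 0" for e
    proof -
      obtain N where N: "\<forall>m\<ge>N. \<forall>n\<ge>N. \<forall>x\<in>?S. \<forall>h. norm (D m x h - D n x h) \<le> e * norm h"
        using est[OF e] by blast
      have le: "norm (D n x h - D' x h) \<le> e * norm h" if "n \<ge> N" "x \<in> ?S" for n x h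
      proof (rule LIMSEQ_le_const2)
        show "(\<lambda>m. norm (D n x h - D m x h)) \<longlonglongrightarrow> norm (D n x h - D' x h)"
          by (intro tendsto_intros conv that)
        show "\<exists>M. \<forall>m\<ge>M. norm (D n x h - D m x h) \<le> e * norm h" using N that by blast
      qed
      show ?thesis
      proof (rule eventually_sequentiallyI[of N], intro ballI allI)
        fix n x h assume "N \<le> n" "x \<in> ?S"
        thus "norm (D n x h - D' x h) \<le> e * norm h" by (rule le)
      qed
    qed
    show "(\<lambda>n. f n z) \<longlonglongrightarrow> g z"
      using tendsto_uniform_limitI[OF ul, of z] r by simp
  qed
  then obtain G where G: "\<And>x. x \<in> ?S \<Longrightarrow> (\<lambda>n. f n x) \<longlonglongrightarrow> G x"
    "\<And>x. x \<in> ?S \<Longrightarrow> (G has_derivative D' x) (at x within ?S)" by blast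
  have "g x = G x" if "x \<in> ?S" for x
  proof (rule LIMSEQ_unique[OF _ G(1)[OF that]])
    show "(\<lambda>n. f n x) \<longlonglongrightarrow> g x"
      using tendsto_uniform_limitI[OF ul, of x] that r by (simp add: s_def)
  qed
  hence "(g has_derivative D' z) (at z within ?S)"
    using has_derivative_transform[OF zS _ G(2)[OF zS], of g] by blast
  hence "(g has_derivative D' z) (at z)"
    using at_within_open[OF zS] by simp
  thus "\<exists>D. (g has_derivative D) (at z) \<and> Vector_Spaces.linear (*s) (*) D" using lin[OF zS] by blast
qed

section \<open>The mean value property on balls\<close>

text \<open>
  Cauchy's integral formula at the centre of the unit circle, written as an average over the
  angle.
\<close>
lemma circle_mean_value:
  assumes hol: "g holomorphic_on cball 0 1"
  shows "(LINT t:{0..1}|lborel. g (cis (2 * pi * t))) = g 0"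
proof -
  have "((\<lambda>u. g u / (u - 0)) has_contour_integral (2 * of_real pi * \<i> * g 0)) (circlepath 0 1)"
    using hol by (intro Cauchy_integral_circlepath_simple) auto
  hence "((\<lambda>t. g (circlepath 0 1 t) / circlepath 0 1 t * vector_derivative (circlepath 0 1) (at t within {0..1}))
      has_integral (2 * of_real pi * \<i> * g 0)) {0..1}"
    by (simp add: has_contour_integral_def)
  hence "((\<lambda>t. 2 * of_real pi * \<i> * g (cis (2 * pi * t))) has_integral (2 * of_real pi * \<i> * g 0)) {0..1}"
  proof (rule has_integral_eq[rotated])
    fix t :: real assume "t \<in> {0..1}"
    moreover have "circlepath 0 1 t = cis (2 * pi * t)"
      by (simp add: circlepath cis_conv_exp mult_ac)
    ultimately show "g (circlepath 0 1 t) / circlepath 0 1 t * vector_derivative (circlepath 0 1) (at t within {0..1})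
        = 2 * of_real pi * \<i> * g (cis (2 * pi * t))"
      by (simp add: vector_derivative_circlepath01 cis_conv_exp mult_ac)
  qed
  hence "((\<lambda>t. (1 / (2 * of_real pi * \<i>)) * (2 * of_real pi * \<i> * g (cis (2 * pi * t)))) has_integral
      (1 / (2 * of_real pi * \<i>)) * (2 * of_real pi * \<i> * g 0)) {0..1}"
    by (rule has_integral_mult_right)
  hence I: "((\<lambda>t. g (cis (2 * pi * t))) has_integral g 0) {0..1}" by simp
  have "continuous_on {0..1} (\<lambda>t. g (cis (2 * pi * t)))"
    by (rule continuous_on_compose2[OF holomorphic_on_imp_continuous_on[OF hol]]) (auto intro!: continuous_intros)
  hence "set_integrable lborel {0..1} (\<lambda>t. g (cis (2 * pi * t)))"
    by (intro borel_integrable_atLeastAtMost')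
  from set_borel_integral_eq_integral(2)[OF this] show ?thesis using I by (simp add: integral_unique)
qed

text \<open>
  For fixed \<open>w\<close>, the circle mean value property in the complex line through \<open>z\<close> and \<open>z + w\<close> gives \<open>f z\<close> as the average
  of \<open>f (z + cis \<theta> *s w)\<close> over \<open>\<theta>\<close>. Integrate over \<open>w\<close> in the ball and exchange the integrals: for each
  \<open>\<theta>\<close> rotation invariance turns the integral over \<open>w\<close> into that of \<open>f (z + w)\<close>.
\<close>
theorem ball_mean_value:
  fixes f :: "complex ^ 'n \<Rightarrow> complex"
  assumes hol: "holomorphic_sv f \<Omega>" and sub: "cball z r \<subseteq> \<Omega>"
  shows "integrable lborel (\<lambda>w. indicat_real (ball z r) w *\<^sub>R f w)"
    and "(\<integral>w. indicat_real (ball z r) w *\<^sub>R f w \<partial>lborel) = of_real (measure lborel (ball z r)) * f z"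
proof -
  have cont: "continuous_on (cball z r) f"
    using holomorphic_sv_continuous_on[OF hol] sub by (rule continuous_on_subset)
  obtain M where M: "\<And>y. y \<in> cball z r \<Longrightarrow> norm (f y) \<le> M"
    using compact_imp_bounded[OF compact_continuous_image[OF cont compact_cball]]
    unfolding bounded_iff by blast
  have contb: "continuous_on (ball z r) f" using cont by (rule continuous_on_subset) auto
  have meas: "(\<lambda>w. indicat_real (ball z r) w *\<^sub>R f w) \<in> borel_measurable borel"
    using contb by (intro borel_measurable_continuous_on_indicator) auto
  have fin: "emeasure lborel (ball a r) < \<infinity>" for a :: "complex ^ 'n"
    by (rule emeasure_bounded_finite) simp
  show int: "integrable lborel (\<lambda>w. indicat_real (ball z r) w *\<^sub>R f w)"
  proof (rule integrableI_bounded_set[where A="ball z r" and B=M])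
    show "AE w in lborel. w \<in> ball z r \<longrightarrow> norm (indicat_real (ball z r) w *\<^sub>R f w) \<le> M"
      using M by (intro AE_I2) auto
  qed (use meas fin in auto)
  define G where "G = (\<lambda>w. indicat_real (ball 0 r) w *\<^sub>R f (z + w))"
  have shift: "G = (\<lambda>w. indicat_real (ball z r) (z + w) *\<^sub>R f (z + w))"
    by (auto simp: G_def indicator_def dist_norm)
  have Gm[measurable]: "G \<in> borel_measurable borel"
    unfolding shift using meas by (rule measurable_compose[rotated]) simp
  have IG: "(\<integral>w. G w \<partial>lborel) = (\<integral>w. indicat_real (ball z r) w *\<^sub>R f w \<partial>lborel)"
  proof -
    have "(\<integral>w. indicat_real (ball z r) w *\<^sub>R f w \<partial>lborel) = (\<integral>w. indicat_real (ball z r) w *\<^sub>R f w \<partial>distr lborel borel ((+) z))"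
      by (simp add: lborel_distr_plus)
    also have "\<dots> = (\<integral>w. G w \<partial>lborel)" unfolding shift using meas by (subst integral_distr) auto
    finally show ?thesis ..
  qed
  have GM: "norm (G w) \<le> M" if "w \<in> ball 0 r" for w
    using M[of "z + w"] that by (simp add: G_def dist_norm)
  have nc: "norm (cis t *s w) = norm w" for t and w :: "complex ^ 'n" by (simp add: norm_cscale)
  have rot: "(\<integral>w. G (cis t *s w) \<partial>lborel) = (\<integral>w. G w \<partial>lborel)" for t
  proof -
    have "continuous_on UNIV (\<lambda>w :: complex ^ 'n. cis t *s w)"
      unfolding vector_scalar_mult_def by (intro continuous_intros continuous_on_vec_lambda)
    hence m: "(\<lambda>w :: complex ^ 'n. cis t *s w) \<in> borel_measurable borel" by (rule borel_measurable_continuous_onI)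
    have "(\<integral>w. G w \<partial>lborel) = (\<integral>w. G w \<partial>distr lborel borel (\<lambda>w. cis t *s w))"
      by (simp add: lborel_distr_unimodular)
    also have "\<dots> = (\<integral>w. G (cis t *s w) \<partial>lborel)" using m by (subst integral_distr) auto
    finally show ?thesis ..
  qed
  define F where "F = (\<lambda>t w. indicat_real {0..1} t *\<^sub>R G (cis (2 * pi * t) *s w))"
  have "continuous_on UNIV (\<lambda>x :: real \<times> (complex ^ 'n). cis (2 * pi * fst x) *s snd x)"
    unfolding vector_scalar_mult_def by (intro continuous_intros continuous_on_vec_lambda)
  hence m2: "(\<lambda>x :: real \<times> (complex ^ 'n). cis (2 * pi * fst x) *s snd x) \<in> borel_measurable borel"
    by (rule borel_measurable_continuous_onI)
  have "(\<lambda>x. G (cis (2 * pi * fst x) *s snd x)) \<in> borel_measurable borel"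
    using m2 Gm by (rule measurable_compose)
  hence Gc: "(\<lambda>x. G (cis (2 * pi * fst x) *s snd x)) \<in> borel_measurable (lborel \<Otimes>\<^sub>M lborel)"
    by (simp add: lborel_prod)
  have Fi: "integrable (lborel \<Otimes>\<^sub>M lborel) (case_prod F)"
  proof (rule integrableI_bounded_set[where A="{0..1} \<times> ball 0 r" and B=M])
    show "emeasure (lborel \<Otimes>\<^sub>M lborel) ({0..1::real} \<times> ball (0::complex^'n) r) < \<infinity>"
      using fin[of 0] by (subst lborel.emeasure_pair_measure_Times) (auto simp: ennreal_mult_less_top)
    show "case_prod F \<in> borel_measurable (lborel \<Otimes>\<^sub>M lborel)"
      unfolding F_def split_beta using Gc by measurable
    show "AE x in lborel \<Otimes>\<^sub>M lborel. x \<in> {0..1} \<times> ball 0 r \<longrightarrow> norm (case_prod F x) \<le> M"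
      by (intro AE_I2) (auto simp: F_def nc intro!: GM)
    show "AE x in lborel \<Otimes>\<^sub>M lborel. x \<notin> {0..1} \<times> ball 0 r \<longrightarrow> case_prod F x = 0"
      by (intro AE_I2) (auto simp: F_def G_def nc indicator_def)
  qed auto
  have mv: "(\<integral>t. F t w \<partial>lborel) = indicat_real (ball 0 r) w *\<^sub>R f z" for w
  proof (cases "w \<in> ball 0 r")
    case True
    have "(\<lambda>\<zeta>. f (z + \<zeta> *s w)) holomorphic_on cball 0 1"
    proof (rule holomorphic_on_subset[OF holomorphic_on_complex_line[OF hol]])
      have "norm (\<zeta> *s w) \<le> r" if "norm \<zeta> \<le> 1" for \<zeta>
        using that True mult_left_le_one_le[of "norm w" "norm \<zeta>"] by (simp add: norm_cscale)
      thus "cball 0 1 \<subseteq> {\<zeta>. z + \<zeta> *s w \<in> \<Omega>}" using sub by (force simp: dist_norm)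
    qed
    from circle_mean_value[OF this] show ?thesis
      using True by (simp add: F_def G_def nc set_lebesgue_integral_def)
  next
    case False
    thus ?thesis by (simp add: F_def G_def nc)
  qed
  have one: "(\<integral>t. indicat_real {0..1::real} t *\<^sub>R c \<partial>lborel) = c" for c :: complex
    by (subst integral_scaleR_left) auto
  have "(\<integral>w. (\<integral>t. F t w \<partial>lborel) \<partial>lborel) = (\<integral>t. (\<integral>w. F t w \<partial>lborel) \<partial>lborel)"
    by (rule lborel_pair.Fubini_integral[OF Fi])
  also have "\<dots> = (\<integral>t. indicat_real {0..1::real} t *\<^sub>R (\<integral>w. G w \<partial>lborel) \<partial>lborel)"
    by (simp add: F_def rot)
  also have "\<dots> = (\<integral>w. G w \<partial>lborel)"
    by (rule one)
  finally have "(\<integral>w. G w \<partial>lborel) = (\<integral>w. indicat_real (ball 0 r) w *\<^sub>R f z \<partial>(lborel :: (complex^'n) measure))"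
    by (simp add: mv)
  also have "\<dots> = of_real (measure lborel (ball (0::complex^'n) r)) * f z"
    using fin[of 0] by (subst integral_scaleR_left) (auto simp: scaleR_conv_of_real)
  also have "measure lborel (ball (0::complex^'n) r) = measure lborel (ball z r)"
  proof -
    have "emeasure lborel (ball z r) = emeasure (distr lborel borel ((+) z)) (ball z r)" by (simp add: lborel_distr_plus)
    also have "\<dots> = emeasure lborel (ball (0::complex^'n) r)"
    proof (subst emeasure_distr)
      have "(+) z -` ball z r = ball 0 r" by (auto simp: dist_norm)
      thus "emeasure lborel ((+) z -` ball z r \<inter> space lborel) = emeasure lborel (ball (0::complex^'n) r)" by simp
    qed auto
    finally show ?thesis by (simp add: measure_def)
  qed
  finally show "(\<integral>w. indicat_real (ball z r) w *\<^sub>R f w \<partial>lborel) = of_real (measure lborel (ball z r)) * f z"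
    by (simp add: IG)
qed

lemma bounded_in_Lr:
  assumes fin: "emeasure lebesgue \<Omega> < \<infinity>" and \<Omega>: "\<Omega> \<in> sets lebesgue" and r: "r > 0"
    and f: "f \<in> borel_measurable (lebesgue_on \<Omega>)" and M: "\<And>x. norm (f x) \<le> M"
  shows "f \<in> Lr \<Omega> r"
proof -
  have "emeasure (lebesgue_on \<Omega>) \<Omega> < \<infinity>"
    using fin \<Omega> by (subst emeasure_restrict_space) auto
  hence "integrable (lebesgue_on \<Omega>) (\<lambda>x. norm (f x) powr r)"
    using f r M \<Omega>
    by (intro integrableI_bounded_set[where A=\<Omega> and B="M powr r"])
       (auto intro!: powr_mono2 simp: sets_restrict_space_iff)
  thus ?thesis using f by (simp add: Lr_def)
qed

definition ball_average :: "complex ^ 'n \<Rightarrow> real \<Rightarrow> complex ^ 'n \<Rightarrow> complex" where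
  "ball_average z r = (\<lambda>w. of_real (indicat_real (ball z r) w / measure lborel (ball z r)))"

lemma ball_average_measurable: "ball_average z r \<in> borel_measurable (lebesgue_on \<Omega>)"
proof -
  define v where "v = measure lborel (ball z r)"
  have [measurable]: "indicat_real (ball z r) \<in> borel_measurable borel"
    by (rule borel_measurable_indicator) simp
  have "ball_average z r \<in> borel_measurable borel"
    unfolding ball_average_def v_def[symmetric] by measurable
  thus ?thesis by (simp add: measurable_completion measurable_restrict_space1)
qed

lemma ball_average_bounded: "norm (ball_average z r w) \<le> 1 / measure lborel (ball z r)"
  by (auto simp: ball_average_def indicator_def norm_divide)

text \<open>
  The mean value property represents evaluation at \<open>z\<close> by a bounded function, which lies in every
  $L^p$ of a bounded set.
\<close>
lemma pairing_ball_average: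
  fixes f :: "complex ^ 'n \<Rightarrow> complex"
  assumes hol: "holomorphic_sv f \<Omega>" and sub: "cball z r \<subseteq> \<Omega>" and r: "r > 0" and \<Omega>: "open \<Omega>"
  shows "pairing \<Omega> f (ball_average z r) = f z"
proof -
  let ?v = "measure lborel (ball z r)"
  have v: "?v > 0" using r content_ball_pos[of r z] by simp
  have "pairing \<Omega> f (ball_average z r) = (\<integral>w. indicat_real \<Omega> w *\<^sub>R (f w * cnj (ball_average z r w)) \<partial>lebesgue)"
    unfolding pairing_def using \<Omega> by (subst integral_restrict_space) auto
  also have "\<dots> = (\<integral>w. (indicat_real (ball z r) w *\<^sub>R f w) / of_real ?v \<partial>lebesgue)"
  proof (intro Bochner_Integration.integral_cong refl)
    fix w
    have "w \<in> ball z r \<Longrightarrow> w \<in> \<Omega>" using sub ball_subset_cball[of z r] by blast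
    thus "indicat_real \<Omega> w *\<^sub>R (f w * cnj (ball_average z r w)) = (indicat_real (ball z r) w *\<^sub>R f w) / of_real ?v"
      by (cases "w \<in> ball z r") (auto simp: ball_average_def simp del: mem_ball)
  qed
  also have "\<dots> = (\<integral>w. indicat_real (ball z r) w *\<^sub>R f w \<partial>lebesgue) / of_real ?v" by simp
  also have "(\<integral>w. indicat_real (ball z r) w *\<^sub>R f w \<partial>lebesgue) = (\<integral>w. indicat_real (ball z r) w *\<^sub>R f w \<partial>lborel)"
    using ball_mean_value(1)[OF hol sub] by (intro integral_completion) auto
  also have "\<dots> = of_real ?v * f z" by (rule ball_mean_value(2)[OF hol sub])
  finally show ?thesis using v by simp
qed

section \<open>Hilbert space identities\<close>

lemma pairing_cnj: "pairing \<Omega> g f = cnj (pairing \<Omega> f g)"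
proof -
  have "cnj (pairing \<Omega> f g) = (\<integral>x. cnj (f x * cnj (g x)) \<partial>lebesgue_on \<Omega>)"
    unfolding pairing_def by (rule Bochner_Integration.integral_cnj[symmetric])
  thus ?thesis by (simp add: pairing_def mult.commute)
qed

lemma pairing_add_left:
  assumes "p > 1" "1 / p + 1 / q = 1" "f \<in> Lr \<Omega> q" "g \<in> Lr \<Omega> q" "h \<in> Lr \<Omega> p"
  shows "pairing \<Omega> (\<lambda>x. f x + g x) h = pairing \<Omega> f h + pairing \<Omega> g h"
  unfolding pairing_def using assms
  by (simp add: distrib_right integrable_pairing[OF assms(1,2)] Bochner_Integration.integral_add)

lemma pairing_cmult_left: "pairing \<Omega> (\<lambda>x. c * f x) h = c * pairing \<Omega> f h"
  unfolding pairing_def by (simp add: mult.assoc)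

lemma pairing_diff_left:
  assumes "p > 1" "1 / p + 1 / q = 1" "f \<in> Lr \<Omega> q" "g \<in> Lr \<Omega> q" "h \<in> Lr \<Omega> p"
  shows "pairing \<Omega> (\<lambda>x. f x - g x) h = pairing \<Omega> f h - pairing \<Omega> g h"
  unfolding pairing_def using assms
  by (simp add: left_diff_distrib integrable_pairing[OF assms(1,2)] Bochner_Integration.integral_diff)

lemma pairing_diff_right:
  assumes "p > 1" "1 / p + 1 / q = 1" "f \<in> Lr \<Omega> p" "g \<in> Lr \<Omega> p" "h \<in> Lr \<Omega> q"
  shows "pairing \<Omega> h (\<lambda>x. f x - g x) = pairing \<Omega> h f - pairing \<Omega> h g"
  unfolding pairing_def using assms
  by (simp add: right_diff_distrib integrable_pairing[OF assms(1,2)] Bochner_Integration.integral_diff)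

lemma pairing_self: "pairing \<Omega> f f = of_real ((Lr_norm \<Omega> 2 f)\<^sup>2)"
proof -
  have "(Lr_norm \<Omega> 2 f)\<^sup>2 = Lr_norm \<Omega> 2 f powr 2" by (simp add: Lr_norm_nonneg)
  also have "\<dots> = (\<integral>x. (norm (f x))\<^sup>2 \<partial>lebesgue_on \<Omega>)" by (simp add: Lr_norm_powr)
  finally show ?thesis
    unfolding pairing_def by (simp add: complex_norm_square[symmetric] flip: of_real_power)
qed

lemma Lr_norm_add_sq:
  assumes "f \<in> Lr \<Omega> 2" "g \<in> Lr \<Omega> 2"
  shows "(Lr_norm \<Omega> 2 (\<lambda>x. f x + g x))\<^sup>2 = (Lr_norm \<Omega> 2 f)\<^sup>2 + (Lr_norm \<Omega> 2 g)\<^sup>2 + 2 * Re (pairing \<Omega> f g)"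
proof -
  have s: "(\<lambda>x. f x + g x) \<in> Lr \<Omega> 2" by (rule Lr_add) (use assms in auto)
  have "complex_of_real ((Lr_norm \<Omega> 2 (\<lambda>x. f x + g x))\<^sup>2)
      = pairing \<Omega> f (\<lambda>x. f x + g x) + pairing \<Omega> g (\<lambda>x. f x + g x)"
    unfolding pairing_self[symmetric] by (rule pairing_add_left[of 2]) (use assms s in auto)
  also have "\<dots> = cnj (pairing \<Omega> (\<lambda>x. f x + g x) f) + cnj (pairing \<Omega> (\<lambda>x. f x + g x) g)"
    by (simp only: pairing_cnj[of \<Omega> f "\<lambda>x. f x + g x"] pairing_cnj[of \<Omega> g "\<lambda>x. f x + g x"])
  also have "\<dots> = cnj (pairing \<Omega> f f + pairing \<Omega> g f) + cnj (pairing \<Omega> f g + pairing \<Omega> g g)"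
    using assms by (simp add: pairing_add_left[of 2 2])
  finally have "Re (complex_of_real ((Lr_norm \<Omega> 2 (\<lambda>x. f x + g x))\<^sup>2)) =
      Re (cnj (pairing \<Omega> f f + pairing \<Omega> g f) + cnj (pairing \<Omega> f g + pairing \<Omega> g g))" by simp
  moreover have "Re (pairing \<Omega> g f) = Re (pairing \<Omega> f g)" by (subst pairing_cnj) simp
  ultimately show ?thesis by (simp add: pairing_self del: of_real_power)
qed

lemma Lr_norm_diff_sq:
  assumes "f \<in> Lr \<Omega> 2" "g \<in> Lr \<Omega> 2"
  shows "(Lr_norm \<Omega> 2 (\<lambda>x. f x - g x))\<^sup>2 = (Lr_norm \<Omega> 2 f)\<^sup>2 + (Lr_norm \<Omega> 2 g)\<^sup>2 - 2 * Re (pairing \<Omega> f g)"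
proof -
  have g': "(\<lambda>x. - g x) \<in> Lr \<Omega> 2" using Lr_cmult[OF assms(2), of "-1"] by simp
  have "pairing \<Omega> f (\<lambda>x. - g x) = - pairing \<Omega> f g" by (simp add: pairing_def)
  with Lr_norm_add_sq[OF assms(1) g'] show ?thesis by (simp add: Lr_norm_minus)
qed

lemma Lr_parallelogram:
  assumes "f \<in> Lr \<Omega> 2" "g \<in> Lr \<Omega> 2"
  shows "(Lr_norm \<Omega> 2 (\<lambda>x. f x + g x))\<^sup>2 + (Lr_norm \<Omega> 2 (\<lambda>x. f x - g x))\<^sup>2
    = 2 * (Lr_norm \<Omega> 2 f)\<^sup>2 + 2 * (Lr_norm \<Omega> 2 g)\<^sup>2"
  using Lr_norm_add_sq[OF assms] Lr_norm_diff_sq[OF assms] by simp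

section \<open>Bergman spaces\<close>

lemma bergman_space_add:
  assumes "r \<ge> 1" "f \<in> bergman_space \<Omega> r" "g \<in> bergman_space \<Omega> r"
  shows "(\<lambda>x. f x + g x) \<in> bergman_space \<Omega> r"
  using assms by (auto simp: bergman_space_def intro!: Lr_add holomorphic_sv_add)

lemma bergman_space_cmult:
  assumes "f \<in> bergman_space \<Omega> r"
  shows "(\<lambda>x. c * f x) \<in> bergman_space \<Omega> r"
  using assms by (auto simp: bergman_space_def intro!: Lr_cmult holomorphic_sv_cmult)

lemma bergman_space_diff:
  assumes "r \<ge> 1" "f \<in> bergman_space \<Omega> r" "g \<in> bergman_space \<Omega> r"
  shows "(\<lambda>x. f x - g x) \<in> bergman_space \<Omega> r"
  using bergman_space_add[OF assms(1,2) bergman_space_cmult[OF assms(3), of "-1"]] by simp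

lemma bergman_space_Lr: "f \<in> bergman_space \<Omega> r \<Longrightarrow> f \<in> Lr \<Omega> r"
  by (simp add: bergman_space_def)

lemma bounded_open_lebesgue:
  fixes \<Omega> :: "(complex ^ 'n) set"
  assumes "open \<Omega>" "bounded \<Omega>"
  shows "\<Omega> \<in> sets lebesgue" "emeasure lebesgue \<Omega> < \<infinity>"
  using lmeasurable_open[OF assms(2,1)] by (auto simp: fmeasurable_def)

text \<open>
  The mean value property and the Cauchy--Schwarz inequality. The constant does not
  depend on \<open>z\<close>, which makes convergence in norm locally uniform.
\<close>
lemma bergman_evaluation_bound:
  fixes \<Omega> :: "(complex ^ 'n) set"
  assumes \<Omega>: "open \<Omega>" "bounded \<Omega>" and r: "r > 0"
  shows "\<exists>K\<ge>0. \<forall>z f. cball z r \<subseteq> \<Omega> \<longrightarrow> f \<in> bergman_space \<Omega> 2 \<longrightarrow> norm (f z) \<le> K * Lr_norm \<Omega> 2 f"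
proof -
  note fin = bounded_open_lebesgue[OF \<Omega>]
  define v where "v = measure lborel (ball (0 :: complex ^ 'n) r)"
  have v: "measure lborel (ball z r) = v" for z :: "complex ^ 'n"
    using r by (simp add: v_def content_ball)
  have vp: "v > 0" using r content_ball_pos[of r "0 :: complex ^ 'n"] by (simp add: v_def)
  define W where "W = measure (lebesgue_on \<Omega>) \<Omega>"
  define K where "K = (W * (1 / v) powr 2) powr (1/2)"
  have "norm (f z) \<le> K * Lr_norm \<Omega> 2 f" if sub: "cball z r \<subseteq> \<Omega>" and f: "f \<in> bergman_space \<Omega> 2" for z f
  proof -
    have a: "ball_average z r \<in> Lr \<Omega> 2"
      using ball_average_bounded by (intro bounded_in_Lr[OF fin(2,1)] ball_average_measurable) auto
    have "Lr_norm \<Omega> 2 (ball_average z r) \<le> K"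
    proof -
      have nn: "emeasure (lebesgue_on \<Omega>) \<Omega> < \<infinity>"
        using fin by (subst emeasure_restrict_space) auto
      have "(\<integral>x. norm (ball_average z r x) powr 2 \<partial>lebesgue_on \<Omega>) \<le> (\<integral>x. (1 / v) powr 2 \<partial>lebesgue_on \<Omega>)"
      proof (rule integral_mono)
        show "integrable (lebesgue_on \<Omega>) (\<lambda>x. norm (ball_average z r x) powr 2)" using a by (simp add: Lr_def)
        show "integrable (lebesgue_on \<Omega>) (\<lambda>x. (1 / v) powr 2 :: real)"
          using nn by (intro finite_measure.integrable_const finite_measureI) simp
        show "norm (ball_average z r x) powr 2 \<le> (1 / v) powr 2" for x
          using ball_average_bounded[of z r x] unfolding v by (intro powr_mono2) auto
      qed
      also have "\<dots> = W * (1 / v) powr 2" by (simp add: W_def)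
      finally show ?thesis unfolding K_def Lr_norm_def by (intro powr_mono2) (auto simp: integral_nonneg_AE)
    qed
    hence *: "Lr_norm \<Omega> 2 f * Lr_norm \<Omega> 2 (ball_average z r) \<le> Lr_norm \<Omega> 2 f * K"
      by (intro mult_left_mono) (auto simp: Lr_norm_nonneg)
    have "norm (f z) = norm (pairing \<Omega> f (ball_average z r))"
      using f sub r \<Omega> by (subst pairing_ball_average) (auto simp: bergman_space_def)
    also have "\<dots> \<le> Lr_norm \<Omega> 2 f * Lr_norm \<Omega> 2 (ball_average z r)"
      using f a by (intro Holder_pairing) (auto simp: bergman_space_def)
    finally show ?thesis using * by (simp add: mult.commute)
  qed
  moreover have "K \<ge> 0" by (simp add: K_def)
  ultimately show ?thesis by blast
qed

lemma bergman_space_norm_zero: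
  assumes \<Omega>: "open \<Omega>" "bounded \<Omega>" and f: "f \<in> bergman_space \<Omega> 2" "Lr_norm \<Omega> 2 f = 0"
  shows "f = (\<lambda>x. 0)"
proof
  fix z
  show "f z = 0"
  proof (cases "z \<in> \<Omega>")
    case True
    then obtain r where r: "r > 0" "cball z r \<subseteq> \<Omega>" using \<Omega> open_contains_cball by blast
    with bergman_evaluation_bound[OF \<Omega> r(1)] f show ?thesis by fastforce
  qed (use f in \<open>auto simp: bergman_space_def\<close>)
qed

lemma bergman_space_self_orthogonal:
  assumes \<Omega>: "open \<Omega>" "bounded \<Omega>" and f: "f \<in> bergman_space \<Omega> 2" "pairing \<Omega> f f = 0"
  shows "f = (\<lambda>x. 0)"
  using bergman_space_norm_zero[OF \<Omega> f(1)] f(2) by (simp add: pairing_self)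

section \<open>The Bergman projection and kernel\<close>

text \<open>
  The limit of a minimising sequence is taken pointwise, using locally uniform
  convergence; Fatou's lemma shows that it belongs to the space and attains the minimum.
  Orthogonality is the first-order condition at the minimum.
\<close>
theorem orthogonal_projection_exists:
  fixes \<Omega> :: "(complex ^ 'n) set"
  assumes \<Omega>: "open \<Omega>" "bounded \<Omega>" and f: "f \<in> Lr \<Omega> 2"
  shows "\<exists>h\<in>bergman_space \<Omega> 2. \<forall>g\<in>bergman_space \<Omega> 2. pairing \<Omega> (\<lambda>x. f x - h x) g = 0"
proof -
  let ?A = "bergman_space \<Omega> 2"
  define N where "N = (\<lambda>u. (Lr_norm \<Omega> 2 u)\<^sup>2)"
  define d where "d = (INF h\<in>?A. N (\<lambda>x. f x - h x))"
  have zero: "(\<lambda>x. 0) \<in> ?A"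
    by (auto simp: bergman_space_def Lr_zero holomorphic_sv_def complex_linear_iff intro!: exI[of _ "\<lambda>h. 0"])
  have bdd: "bdd_below ((\<lambda>h. N (\<lambda>x. f x - h x)) ` ?A)" by (intro bdd_belowI2[of _ 0]) (simp add: N_def)
  have d_le: "d \<le> N (\<lambda>x. f x - h x)" if "h \<in> ?A" for h
    unfolding d_def by (rule cINF_lower[OF bdd that])
  have d0: "d \<ge> 0" unfolding d_def using zero by (intro cINF_greatest) (auto simp: N_def)
  have "\<exists>h\<in>?A. N (\<lambda>x. f x - h x) < d + 1 / real (Suc n)" for n
  proof -
    have ne: "?A \<noteq> {}" using zero by blast
    have "(INF h\<in>?A. N (\<lambda>x. f x - h x)) < d + 1 / real (Suc n)"
      unfolding d_def[symmetric] by simp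
    thus ?thesis using cINF_less_iff[OF ne bdd, of "d + 1 / real (Suc n)"] by blast
  qed
  then obtain h where h: "\<And>n. h n \<in> ?A" and hd: "\<And>n. N (\<lambda>x. f x - h n x) < d + 1 / real (Suc n)" by metis
  have fh: "(\<lambda>x. f x - h n x) \<in> Lr \<Omega> 2" for n
    by (rule Lr_diff) (use f h bergman_space_Lr in auto)
  have close: "N (\<lambda>x. h m x - h n x) \<le> 2 / real (Suc m) + 2 / real (Suc n)" for m n
  proof -
    \<comment> \<open>the midpoint belongs to the space, so its distance to \<open>f\<close> is at least the infimum\<close>
    let ?mid = "\<lambda>x. (1/2) * (h n x + h m x)"
    have mid: "?mid \<in> ?A" by (intro bergman_space_cmult bergman_space_add h) simp
    have "N (\<lambda>x. 2 * (f x - ?mid x)) = 4 * N (\<lambda>x. f x - ?mid x)"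
      unfolding N_def by (subst Lr_norm_cmult) (auto simp: power_mult_distrib)
    moreover have "(\<lambda>x. 2 * (f x - ?mid x)) = (\<lambda>x. (f x - h n x) + (f x - h m x))" by (auto simp: algebra_simps)
    moreover have "(\<lambda>x. h m x - h n x) = (\<lambda>x. (f x - h n x) - (f x - h m x))" by auto
    ultimately have "4 * N (\<lambda>x. f x - ?mid x) + N (\<lambda>x. h m x - h n x)
        = 2 * N (\<lambda>x. f x - h n x) + 2 * N (\<lambda>x. f x - h m x)"
      using Lr_parallelogram[OF fh[of n] fh[of m]] unfolding N_def by simp
    thus ?thesis using d_le[OF mid] hd[of n] hd[of m] by simp
  qed
  have cau: "\<exists>M. \<forall>m\<ge>M. \<forall>n\<ge>M. Lr_norm \<Omega> 2 (\<lambda>x. h m x - h n x) \<le> e" if e: "e > 0" for e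
  proof -
    obtain M :: nat where M: "4 / e\<^sup>2 < real M" using reals_Archimedean2 by blast
    have "Lr_norm \<Omega> 2 (\<lambda>x. h m x - h n x) \<le> e" if "m \<ge> M" "n \<ge> M" for m n
    proof (rule power2_le_imp_le)
      have "4 / e\<^sup>2 \<le> real (Suc k)" if "k \<ge> M" for k using M that by linarith
      hence "2 / real (Suc k) \<le> e\<^sup>2 / 2" if "k \<ge> M" for k using that e by (simp add: field_simps)
      from this[OF \<open>m \<ge> M\<close>] this[OF \<open>n \<ge> M\<close>]
      show "(Lr_norm \<Omega> 2 (\<lambda>x. h m x - h n x))\<^sup>2 \<le> e\<^sup>2" using close[of m n] unfolding N_def by linarith
    qed (use e in auto)
    thus ?thesis by blast
  qed
  have uc: "\<exists>M. \<forall>m\<ge>M. \<forall>n\<ge>M. \<forall>w. cball w r \<subseteq> \<Omega> \<longrightarrow> dist (h m w) (h n w) < e" if r: "r > 0" and e: "e > 0" for r e :: real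
  proof -
    obtain K where K: "K \<ge> 0" "\<And>w u. cball w r \<subseteq> \<Omega> \<Longrightarrow> u \<in> ?A \<Longrightarrow> norm (u w) \<le> K * Lr_norm \<Omega> 2 u"
      using bergman_evaluation_bound[OF \<Omega> r] by blast
    have Kp: "K + 1 > 0" using K(1) by simp
    obtain M where M: "\<forall>m\<ge>M. \<forall>n\<ge>M. Lr_norm \<Omega> 2 (\<lambda>x. h m x - h n x) \<le> e / (K + 1)"
      using cau[of "e / (K + 1)"] e Kp by auto
    have "dist (h m w) (h n w) < e" if "m \<ge> M" "n \<ge> M" "cball w r \<subseteq> \<Omega>" for m n w
    proof -
      have "dist (h m w) (h n w) \<le> K * Lr_norm \<Omega> 2 (\<lambda>x. h m x - h n x)"
        using K(2)[OF that(3) bergman_space_diff[OF _ h h], of m n] by (simp add: dist_norm)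
      also have "\<dots> \<le> K * (e / (K + 1))" using M that K(1) by (intro mult_left_mono) auto
      also have "\<dots> < e" using K(1) Kp e by (simp add: field_simps)
      finally show ?thesis .
    qed
    thus ?thesis by blast
  qed
  define k where "k = (\<lambda>x. if x \<in> \<Omega> then lim (\<lambda>n. h n x) else 0)"
  have ptw: "(\<lambda>n. h n x) \<longlonglongrightarrow> k x" if x: "x \<in> \<Omega>" for x
  proof -
    obtain r where r: "r > 0" "cball x r \<subseteq> \<Omega>" using open_contains_cball[of \<Omega>] \<Omega>(1) x by blast
    have "Cauchy (\<lambda>n. h n x)"
    proof (rule metric_CauchyI)
      fix e :: real assume "e > 0"
      from uc[OF r(1) this] obtain M
        where "\<forall>m\<ge>M. \<forall>n\<ge>M. \<forall>w. cball w r \<subseteq> \<Omega> \<longrightarrow> dist (h m w) (h n w) < e" ..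
      with r(2) show "\<exists>M. \<forall>m\<ge>M. \<forall>n\<ge>M. dist (h m x) (h n x) < e"
        by (intro exI[of _ M] allI impI) simp
    qed
    thus ?thesis using x by (simp add: k_def Cauchy_convergent_iff convergent_LIMSEQ_iff)
  qed
  have holk: "holomorphic_sv k \<Omega>"
  proof (rule holomorphic_sv_uniform_limit)
    show "holomorphic_sv (h n) \<Omega>" for n using h[of n] by (simp add: bergman_space_def)
    fix z assume "z \<in> \<Omega>"
    then obtain s where s: "s > 0" "cball z s \<subseteq> \<Omega>" using \<Omega> open_contains_cball by blast
    define r where "r = s / 2"
    have r: "r > 0" using s by (simp add: r_def)
    have cb: "cball w r \<subseteq> \<Omega>" if "w \<in> ball z r" for w
    proof
      fix y assume "y \<in> cball w r"
      hence "y \<in> cball z s" using that dist_triangle[of z y w] by (simp add: r_def)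
      thus "y \<in> \<Omega>" using s by blast
    qed
    have "uniform_limit (ball z r) h k sequentially"
      unfolding uniform_limit_iff
    proof (intro allI impI)
      fix e :: real assume e: "e > 0"
      obtain M where M: "\<forall>m\<ge>M. \<forall>n\<ge>M. \<forall>w. cball w r \<subseteq> \<Omega> \<longrightarrow> dist (h m w) (h n w) < e / 2"
        using uc[OF r, of "e/2"] e by auto
      show "\<forall>\<^sub>F n in sequentially. \<forall>x\<in>ball z r. dist (h n x) (k x) < e"
      proof (rule eventually_sequentiallyI[of M], intro ballI)
        fix n x assume n: "M \<le> n" and x: "x \<in> ball z r"
        have "x \<in> \<Omega>" using cb[OF x] r by (meson centre_in_cball less_imp_le subsetD)
        have "dist (h n x) (k x) \<le> e / 2"
        proof (rule LIMSEQ_le_const2)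
          show "(\<lambda>m. dist (h n x) (h m x)) \<longlonglongrightarrow> dist (h n x) (k x)"
            by (intro tendsto_intros ptw \<open>x \<in> \<Omega>\<close>)
          show "\<exists>M. \<forall>m\<ge>M. dist (h n x) (h m x) \<le> e / 2"
            using M n cb[OF x] less_imp_le by blast
        qed
        thus "dist (h n x) (k x) < e" using e by simp
      qed
    qed
    moreover have "ball z r \<subseteq> \<Omega>" using cb r by (meson centre_in_cball less_imp_le subsetD subsetI)
    ultimately show "\<exists>r>0. ball z r \<subseteq> \<Omega> \<and> uniform_limit (ball z r) h k sequentially" using r by blast
  qed
  have km: "k \<in> borel_measurable (lebesgue_on \<Omega>)" by (rule holomorphic_sv_measurable[OF holk \<Omega>(1)])
  have fk: "(\<lambda>x. f x - k x) \<in> Lr \<Omega> 2 \<and> Lr_norm \<Omega> 2 (\<lambda>x. f x - k x) \<le> sqrt (d + e)" if e: "e > 0" for e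
  proof -
    have ev: "\<forall>\<^sub>F n in sequentially. Lr_norm \<Omega> 2 (\<lambda>x. f x - h n x) \<le> sqrt (d + e)"
    proof -
      obtain M where "M \<noteq> 0" "inverse (real M) < e" using ex_inverse_of_nat_less[OF e] by auto
      show ?thesis
      proof (rule eventually_sequentiallyI[of M])
        fix n assume "M \<le> n"
        hence "1 / real (Suc n) \<le> inverse (real M)"
          using \<open>M \<noteq> 0\<close> by (simp add: field_simps)
        hence "(Lr_norm \<Omega> 2 (\<lambda>x. f x - h n x))\<^sup>2 \<le> d + e"
          using hd[of n] \<open>inverse (real M) < e\<close> unfolding N_def by linarith
        thus "Lr_norm \<Omega> 2 (\<lambda>x. f x - h n x) \<le> sqrt (d + e)" by (rule real_le_rsqrt)
      qed
    qed
    have lim: "AE x in lebesgue_on \<Omega>. (\<lambda>n. f x - h n x) \<longlonglongrightarrow> f x - k x"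
      by (rule AE_I2) (auto intro!: tendsto_intros ptw)
    have meas: "(\<lambda>x. f x - k x) \<in> borel_measurable (lebesgue_on \<Omega>)"
      using Lr_measurable[OF f] km by measurable
    show ?thesis
      using Lr_Fatou[OF _ fh ev _ lim meas] d0 e by auto
  qed
  have fkL: "(\<lambda>x. f x - k x) \<in> Lr \<Omega> 2" using fk[of 1] by simp
  have kA: "k \<in> ?A"
  proof -
    have "k \<in> Lr \<Omega> 2" using Lr_diff[OF _ f fkL] by simp
    thus ?thesis using holk by (simp add: bergman_space_def k_def)
  qed
  have Nk: "N (\<lambda>x. f x - k x) \<le> d"
  proof (rule field_le_epsilon)
    fix e :: real assume e: "e > 0"
    have "N (\<lambda>x. f x - k x) \<le> (sqrt (d + e))\<^sup>2"
      unfolding N_def using fk[OF e] by (intro power_mono) (auto simp: Lr_norm_nonneg)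
    thus "N (\<lambda>x. f x - k x) \<le> d + e" using d0 e by simp
  qed
  have "pairing \<Omega> (\<lambda>x. f x - k x) g = 0" if g: "g \<in> ?A" for g
  proof (cases "N g = 0")
    case True
    hence "g = (\<lambda>x. 0)" using bergman_space_norm_zero[OF \<Omega> g] by (simp add: N_def)
    thus ?thesis by (simp add: pairing_def)
  next
    case False
    hence Ng: "N g > 0" by (simp add: N_def)
    let ?a = "pairing \<Omega> (\<lambda>x. f x - k x) g"
    \<comment> \<open>the step along \<open>g\<close> that would decrease the distance most\<close>
    define c where "c = ?a / of_real (N g)"
    have kc: "(\<lambda>x. k x + c * g x) \<in> ?A" by (intro bergman_space_add bergman_space_cmult kA g) simp
    have "N (\<lambda>x. f x - (k x + c * g x)) = N (\<lambda>x. (f x - k x) - c * g x)"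
      by (simp add: diff_diff_eq)
    also have "\<dots> = N (\<lambda>x. f x - k x) + N (\<lambda>x. c * g x) - 2 * Re (pairing \<Omega> (\<lambda>x. f x - k x) (\<lambda>x. c * g x))"
      unfolding N_def by (rule Lr_norm_diff_sq[OF fkL Lr_cmult[OF bergman_space_Lr[OF g]]])
    also have "N (\<lambda>x. c * g x) = (norm c)\<^sup>2 * N g"
      unfolding N_def by (subst Lr_norm_cmult) (auto simp: power_mult_distrib)
    also have "pairing \<Omega> (\<lambda>x. f x - k x) (\<lambda>x. c * g x) = cnj c * ?a"
      by (subst (1 2) pairing_cnj) (simp add: pairing_cmult_left)
    also have "cnj c * ?a = of_real ((norm c)\<^sup>2 * N g)"
    proof -
      have "?a = c * of_real (N g)" using Ng by (simp add: c_def)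
      hence "cnj c * ?a = (c * cnj c) * of_real (N g)" by (simp only: mult_ac)
      thus ?thesis by (simp add: complex_norm_square[symmetric])
    qed
    finally have "N (\<lambda>x. f x - (k x + c * g x)) = N (\<lambda>x. f x - k x) - (norm c)\<^sup>2 * N g" by simp
    with d_le[OF kc] Nk have "(norm c)\<^sup>2 * N g \<le> 0" by linarith
    hence "c = 0" using Ng by (simp add: mult_le_0_iff)
    thus ?thesis using Ng by (simp add: c_def)
  qed
  thus ?thesis using kA by blast
qed

lemma bergman_projection_eqI:
  fixes \<Omega> :: "(complex ^ 'n) set"
  assumes \<Omega>: "open \<Omega>" "bounded \<Omega>" and f: "f \<in> Lr \<Omega> 2"
    and h: "h \<in> bergman_space \<Omega> 2" "\<And>g. g \<in> bergman_space \<Omega> 2 \<Longrightarrow> pairing \<Omega> (\<lambda>x. f x - h x) g = 0"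
  shows "bergman_projection \<Omega> f = h"
  unfolding bergman_projection_def
proof (rule the_equality)
  show "h \<in> bergman_space \<Omega> 2 \<and> (\<forall>g\<in>bergman_space \<Omega> 2. pairing \<Omega> (\<lambda>x. f x - h x) g = 0)" using h by blast
  fix k assume k: "k \<in> bergman_space \<Omega> 2 \<and> (\<forall>g\<in>bergman_space \<Omega> 2. pairing \<Omega> (\<lambda>x. f x - k x) g = 0)"
  have L: "(\<lambda>x. f x - h x) \<in> Lr \<Omega> 2" "(\<lambda>x. f x - k x) \<in> Lr \<Omega> 2"
    by (rule Lr_diff; use f h k bergman_space_Lr in force)+
  let ?u = "\<lambda>x. k x - h x"
  have u: "?u \<in> bergman_space \<Omega> 2" by (rule bergman_space_diff) (use h k in auto)
  have "pairing \<Omega> (\<lambda>x. (f x - h x) - (f x - k x)) ?u = 0"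
    using h(2)[OF u] k u L by (subst pairing_diff_left[of 2]) (auto intro: bergman_space_Lr)
  hence "?u = (\<lambda>x. 0)" by (intro bergman_space_self_orthogonal[OF \<Omega> u]) simp
  thus "k = h" by (metis eq_iff_diff_eq_0 ext)
qed

lemma bergman_projection:
  fixes \<Omega> :: "(complex ^ 'n) set"
  assumes \<Omega>: "open \<Omega>" "bounded \<Omega>" and f: "f \<in> Lr \<Omega> 2"
  shows "bergman_projection \<Omega> f \<in> bergman_space \<Omega> 2"
    and "\<And>g. g \<in> bergman_space \<Omega> 2 \<Longrightarrow> pairing \<Omega> (bergman_projection \<Omega> f) g = pairing \<Omega> f g"
proof -
  obtain h where h: "h \<in> bergman_space \<Omega> 2" "\<And>g. g \<in> bergman_space \<Omega> 2 \<Longrightarrow> pairing \<Omega> (\<lambda>x. f x - h x) g = 0"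
    using orthogonal_projection_exists[OF \<Omega> f] by blast
  have e: "bergman_projection \<Omega> f = h" by (rule bergman_projection_eqI[OF \<Omega> f h])
  show "bergman_projection \<Omega> f \<in> bergman_space \<Omega> 2" using h e by simp
  show "pairing \<Omega> (bergman_projection \<Omega> f) g = pairing \<Omega> f g" if g: "g \<in> bergman_space \<Omega> 2" for g
    using h(2)[OF g] pairing_diff_left[of 2 2 f \<Omega> h g] f h(1) g by (simp add: e bergman_space_Lr)
qed

lemma bergman_projection_add:
  fixes \<Omega> :: "(complex ^ 'n) set"
  assumes \<Omega>: "open \<Omega>" "bounded \<Omega>" and f: "f \<in> Lr \<Omega> 2" and g: "g \<in> Lr \<Omega> 2"
  shows "bergman_projection \<Omega> (\<lambda>x. f x + g x) = (\<lambda>x. bergman_projection \<Omega> f x + bergman_projection \<Omega> g x)"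
proof (rule bergman_projection_eqI[OF \<Omega>])
  note F = bergman_projection[OF \<Omega> f] and G = bergman_projection[OF \<Omega> g]
  show s: "(\<lambda>x. f x + g x) \<in> Lr \<Omega> 2" by (rule Lr_add) (use f g in auto)
  show S: "(\<lambda>x. bergman_projection \<Omega> f x + bergman_projection \<Omega> g x) \<in> bergman_space \<Omega> 2"
    by (rule bergman_space_add) (use F G in auto)
  fix u assume u: "u \<in> bergman_space \<Omega> 2"
  show "pairing \<Omega> (\<lambda>x. f x + g x - (bergman_projection \<Omega> f x + bergman_projection \<Omega> g x)) u = 0"
    using f g F G u s S
    by (subst pairing_diff_left[of 2]) (auto simp: bergman_space_Lr pairing_add_left[of 2 2])
qed

lemma bergman_projection_cmult:
  fixes \<Omega> :: "(complex ^ 'n) set"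
  assumes \<Omega>: "open \<Omega>" "bounded \<Omega>" and f: "f \<in> Lr \<Omega> 2"
  shows "bergman_projection \<Omega> (\<lambda>x. c * f x) = (\<lambda>x. c * bergman_projection \<Omega> f x)"
proof (rule bergman_projection_eqI[OF \<Omega>])
  note F = bergman_projection[OF \<Omega> f]
  show s: "(\<lambda>x. c * f x) \<in> Lr \<Omega> 2" by (rule Lr_cmult[OF f])
  show S: "(\<lambda>x. c * bergman_projection \<Omega> f x) \<in> bergman_space \<Omega> 2" by (rule bergman_space_cmult[OF F(1)])
  fix u assume u: "u \<in> bergman_space \<Omega> 2"
  show "pairing \<Omega> (\<lambda>x. c * f x - c * bergman_projection \<Omega> f x) u = 0"
    using f F u s S
    by (subst pairing_diff_left[of 2]) (auto simp: bergman_space_Lr pairing_cmult_left)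
qed

lemma bergman_projection_contraction:
  fixes \<Omega> :: "(complex ^ 'n) set"
  assumes \<Omega>: "open \<Omega>" "bounded \<Omega>" and f: "f \<in> Lr \<Omega> 2"
  shows "Lr_norm \<Omega> 2 (bergman_projection \<Omega> f) \<le> Lr_norm \<Omega> 2 f"
proof -
  let ?h = "bergman_projection \<Omega> f"
  note F = bergman_projection[OF \<Omega> f]
  have "(Lr_norm \<Omega> 2 ?h)\<^sup>2 = norm (pairing \<Omega> ?h ?h)"
    by (simp add: pairing_self norm_power Lr_norm_nonneg)
  also have "pairing \<Omega> ?h ?h = pairing \<Omega> f ?h" by (rule F(2)[OF F(1)])
  also have "norm (pairing \<Omega> f ?h) \<le> Lr_norm \<Omega> 2 f * Lr_norm \<Omega> 2 ?h"
    using f F(1) by (intro Holder_pairing) (auto intro: bergman_space_Lr)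
  finally have "Lr_norm \<Omega> 2 ?h * Lr_norm \<Omega> 2 ?h \<le> Lr_norm \<Omega> 2 f * Lr_norm \<Omega> 2 ?h"
    by (simp add: power2_eq_square)
  thus ?thesis
    using Lr_norm_nonneg[of \<Omega> 2 ?h] Lr_norm_nonneg[of \<Omega> 2 f]
    by (cases "Lr_norm \<Omega> 2 ?h = 0") auto
qed

text \<open>
  For \<open>f\<close> in the Bergman space, \<open>f z\<close> is the pairing of \<open>f\<close> with the ball average, which only sees the
  projection of the ball average.
\<close>
lemma bergman_kernel_eq_projection:
  fixes \<Omega> :: "(complex ^ 'n) set"
  assumes \<Omega>: "open \<Omega>" "bounded \<Omega>" and sub: "cball z r \<subseteq> \<Omega>" and r: "r > 0"
  shows "(\<lambda>w. bergman_kernel \<Omega> w z) = bergman_projection \<Omega> (ball_average z r)"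
proof -
  let ?A = "bergman_space \<Omega> 2" and ?k = "bergman_projection \<Omega> (ball_average z r)"
  note fin = bounded_open_lebesgue[OF \<Omega>]
  have a: "ball_average z r \<in> Lr \<Omega> 2"
    using ball_average_bounded by (intro bounded_in_Lr[OF fin(2,1)] ball_average_measurable) auto
  note F = bergman_projection[OF \<Omega> a]
  have ev: "f z = pairing \<Omega> f ?k" if f: "f \<in> ?A" for f
  proof -
    have "pairing \<Omega> f ?k = pairing \<Omega> f (ball_average z r)"
      using F(2)[OF f] by (metis pairing_cnj)
    thus ?thesis using f sub r \<Omega> by (simp add: pairing_ball_average bergman_space_def)
  qed
  have "(THE k. k \<in> ?A \<and> (\<forall>f\<in>?A. f z = pairing \<Omega> f k)) = ?k"
  proof (rule the_equality)
    fix k assume k: "k \<in> ?A \<and> (\<forall>f\<in>?A. f z = pairing \<Omega> f k)"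
    let ?u = "\<lambda>x. k x - ?k x"
    have u: "?u \<in> ?A" by (rule bergman_space_diff) (use k F in auto)
    have "pairing \<Omega> ?u ?u = pairing \<Omega> ?u k - pairing \<Omega> ?u ?k"
      using k F u by (intro pairing_diff_right[of 2]) (auto intro: bergman_space_Lr)
    also have "\<dots> = 0" using k u ev[OF u] by (metis diff_self)
    finally have "?u = (\<lambda>x. 0)" by (rule bergman_space_self_orthogonal[OF \<Omega> u])
    thus "k = ?k" by (metis eq_iff_diff_eq_0 ext)
  qed (use F ev in blast)
  thus ?thesis unfolding bergman_kernel_def by simp
qed

section \<open>Comparison of the indices\<close>

lemma integrability_of_regularity:
  fixes \<Omega> :: "(complex ^ 'n) set"
  assumes \<Omega>: "open \<Omega>" "bounded \<Omega>" and p: "p \<ge> 2" and b: "bergman_projection_bounded \<Omega> p" and z: "z \<in> \<Omega>"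
  shows "(\<lambda>w. bergman_kernel \<Omega> w z) \<in> bergman_space \<Omega> p"
proof -
  note fin = bounded_open_lebesgue[OF \<Omega>]
  obtain r where r: "r > 0" "cball z r \<subseteq> \<Omega>" using \<Omega> z open_contains_cball by blast
  have "ball_average z r \<in> Lr \<Omega> p"
    using ball_average_bounded p by (intro bounded_in_Lr[OF fin(2,1)] ball_average_measurable) auto
  hence "bergman_projection \<Omega> (ball_average z r) \<in> bergman_space \<Omega> p"
    using b by (auto simp: bergman_projection_bounded_def)
  thus ?thesis by (simp add: bergman_kernel_eq_projection[OF \<Omega> r(2,1)])
qed

text \<open>
  Surjectivity makes \<open>B f\<close> an element of the Bergman space of exponent \<open>p\<close> for each \<open>f\<close>
  separately; the uniform boundedness principle turns this into a norm bound.
\<close>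
lemma regularity_of_duality:
  fixes \<Omega> :: "(complex ^ 'n) set"
  assumes \<Omega>: "open \<Omega>" "bounded \<Omega>" and p: "p \<ge> 2" and pq: "1 / p + 1 / q = 1"
    and surj: "bergman_Phi \<Omega> q ` bergman_space \<Omega> p = bergman_dual \<Omega> q"
  shows "bergman_projection_bounded \<Omega> p"
proof -
  let ?B = "bergman_projection \<Omega>"
  note fin = bounded_open_lebesgue[OF \<Omega>]
  have p1: "p > 1" using p by simp
  have q: "1 < q" "q \<le> 2"
  proof -
    have "0 < 1 / p" "1 / p \<le> 1/2" using p by auto
    hence "1/2 \<le> 1 / q" "1 / q < 1" using pq by linarith+
    moreover from this have "q > 0" by (metis less_le_trans half_gt_zero_iff zero_less_divide_1_iff zero_less_one)
    ultimately show "1 < q" "q \<le> 2" by (simp_all add: field_simps)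
  qed
  have qp: "1 / q + 1 / p = 1" using pq by simp
  obtain C2 where C2: "C2 \<ge> 0" "\<And>f. f \<in> Lr \<Omega> p \<Longrightarrow> f \<in> Lr \<Omega> 2" "\<And>f. f \<in> Lr \<Omega> p \<Longrightarrow> Lr_norm \<Omega> 2 f \<le> C2 * Lr_norm \<Omega> p f"
    using Lr_inclusion[OF fin(2,1) _ p] by auto
  have L2q: "f \<in> Lr \<Omega> q" if "f \<in> Lr \<Omega> 2" for f
    using Lr_inclusion[OF fin(2,1) _ q(2)] q(1) that by auto
  have proj: "?B f \<in> bergman_space \<Omega> p" if f: "f \<in> Lr \<Omega> p" for f
  proof -
    \<comment> \<open>the functional whose representative in the Bergman space will be \<open>B f\<close>\<close>
    define l where "l = restrict (\<lambda>h. pairing \<Omega> h f) (bergman_space \<Omega> q)"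
    have "l \<in> bergman_dual \<Omega> q"
      unfolding bergman_dual_def
    proof (intro CollectI conjI ballI allI)
      show "l \<in> extensional (bergman_space \<Omega> q)" by (simp add: l_def)
      show "l (\<lambda>x. g x + h x) = l g + l h" if "g \<in> bergman_space \<Omega> q" "h \<in> bergman_space \<Omega> q" for g h
        using that q(1) f by (simp add: l_def bergman_space_add pairing_add_left[OF p1 pq] bergman_space_Lr)
      show "l (\<lambda>x. c * g x) = c * l g" if "g \<in> bergman_space \<Omega> q" for c g
        using that by (simp add: l_def bergman_space_cmult pairing_cmult_left)
      show "\<exists>C. \<forall>g\<in>bergman_space \<Omega> q. norm (l g) \<le> C * Lr_norm \<Omega> q g"
      proof (intro exI ballI)
        fix g assume g: "g \<in> bergman_space \<Omega> q"
        show "norm (l g) \<le> Lr_norm \<Omega> p f * Lr_norm \<Omega> q g"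
          using Holder_pairing[OF p1 pq bergman_space_Lr[OF g] f] g by (simp add: l_def mult.commute)
      qed
    qed
    then obtain g where g: "g \<in> bergman_space \<Omega> p" and lg: "l = bergman_Phi \<Omega> q g" using surj by blast
    have g2: "g \<in> bergman_space \<Omega> 2" using g C2(2) by (auto simp: bergman_space_def)
    have f2: "f \<in> Lr \<Omega> 2" by (rule C2(2)[OF f])
    have "?B f = g"
    proof (rule bergman_projection_eqI[OF \<Omega> f2 g2])
      fix h assume h: "h \<in> bergman_space \<Omega> 2"
      have hq: "h \<in> bergman_space \<Omega> q" using h L2q by (auto simp: bergman_space_def)
      have "pairing \<Omega> h f = pairing \<Omega> h g"
        using fun_cong[OF lg, of h] hq by (simp add: l_def bergman_Phi_def)
      hence "pairing \<Omega> f h = pairing \<Omega> g h" by (metis pairing_cnj)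
      thus "pairing \<Omega> (\<lambda>x. f x - g x) h = 0"
        using f2 g2 h by (subst pairing_diff_left[of 2]) (auto intro: bergman_space_Lr)
    qed
    thus ?thesis using g by simp
  qed
  define I where "I = {h. h \<in> Lr \<Omega> q \<and> Lr_norm \<Omega> q h \<le> 1 \<and> (\<exists>m. \<forall>x. norm (h x) \<le> m)}"
  have I2: "h \<in> Lr \<Omega> 2" if "h \<in> I" for h
  proof -
    obtain m where m: "\<And>x. norm (h x) \<le> m" and h: "h \<in> Lr \<Omega> q" using \<open>h \<in> I\<close> by (auto simp: I_def)
    show ?thesis by (rule bounded_in_Lr[OF fin(2,1) _ Lr_measurable[OF h] m]) simp
  qed
  have "\<exists>C. \<forall>h\<in>I. \<forall>f\<in>Lr \<Omega> p. norm (pairing \<Omega> (?B f) h) \<le> C * Lr_norm \<Omega> p f"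
  proof (rule Lr_uniform_boundedness)
    show "p \<ge> 1" using p by simp
    show "pairing \<Omega> (?B (\<lambda>x. f x + g x)) h = pairing \<Omega> (?B f) h + pairing \<Omega> (?B g) h"
      if "h \<in> I" "f \<in> Lr \<Omega> p" "g \<in> Lr \<Omega> p" for h f g
      using that C2(2) I2 bergman_projection(1)[OF \<Omega>]
      by (simp add: bergman_projection_add[OF \<Omega>] pairing_add_left[of 2 2] bergman_space_Lr)
    show "pairing \<Omega> (?B (\<lambda>x. c * f x)) h = c * pairing \<Omega> (?B f) h" if "h \<in> I" "f \<in> Lr \<Omega> p" for h c f
      using that C2(2) by (simp add: bergman_projection_cmult[OF \<Omega>] pairing_cmult_left)
    show "\<exists>C. \<forall>f\<in>Lr \<Omega> p. norm (pairing \<Omega> (?B f) h) \<le> C * Lr_norm \<Omega> p f" if h: "h \<in> I" for h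
    proof (intro exI ballI)
      fix f assume f: "f \<in> Lr \<Omega> p"
      have f2: "f \<in> Lr \<Omega> 2" by (rule C2(2)[OF f])
      have "norm (pairing \<Omega> (?B f) h) \<le> Lr_norm \<Omega> 2 (?B f) * Lr_norm \<Omega> 2 h"
        by (rule Holder_pairing) (use bergman_projection(1)[OF \<Omega> f2] I2[OF h] bergman_space_Lr in auto)
      also have "Lr_norm \<Omega> 2 (?B f) \<le> C2 * Lr_norm \<Omega> p f"
        using bergman_projection_contraction[OF \<Omega> f2] C2(3)[OF f] by simp
      finally show "norm (pairing \<Omega> (?B f) h) \<le> (C2 * Lr_norm \<Omega> 2 h) * Lr_norm \<Omega> p f"
        by (simp add: mult_right_mono Lr_norm_nonneg mult_ac)
    qed
    show "\<exists>C. \<forall>h\<in>I. norm (pairing \<Omega> (?B f) h) \<le> C" if f: "f \<in> Lr \<Omega> p" for f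
    proof (intro exI ballI)
      fix h assume h: "h \<in> I"
      have "norm (pairing \<Omega> (?B f) h) \<le> Lr_norm \<Omega> p (?B f) * Lr_norm \<Omega> q h"
        by (rule Holder_pairing[OF q(1) qp]) (use proj[OF f] h bergman_space_Lr in \<open>auto simp: I_def\<close>)
      also have "\<dots> \<le> Lr_norm \<Omega> p (?B f) * 1" using h by (intro mult_left_mono) (auto simp: I_def Lr_norm_nonneg)
      finally show "norm (pairing \<Omega> (?B f) h) \<le> Lr_norm \<Omega> p (?B f)" by simp
    qed
  qed
  then obtain C where C: "\<And>h f. h \<in> I \<Longrightarrow> f \<in> Lr \<Omega> p \<Longrightarrow> norm (pairing \<Omega> (?B f) h) \<le> C * Lr_norm \<Omega> p f" by blast
  have "Lr_norm \<Omega> p (?B f) \<le> \<bar>C\<bar> * Lr_norm \<Omega> p f" if f: "f \<in> Lr \<Omega> p" for f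
  proof (rule Lr_norm_le_dual[OF p1 pq bergman_space_Lr[OF proj[OF f]]])
    show "0 \<le> \<bar>C\<bar> * Lr_norm \<Omega> p f" by (simp add: Lr_norm_nonneg)
    fix h m assume "h \<in> Lr \<Omega> q" "\<And>x. norm (h x) \<le> m" "Lr_norm \<Omega> q h \<le> 1"
    hence "norm (pairing \<Omega> (?B f) h) \<le> C * Lr_norm \<Omega> p f" by (intro C f) (auto simp: I_def)
    also have "\<dots> \<le> \<bar>C\<bar> * Lr_norm \<Omega> p f" by (intro mult_right_mono) (auto simp: Lr_norm_nonneg)
    finally show "norm (pairing \<Omega> (?B f) h) \<le> \<bar>C\<bar> * Lr_norm \<Omega> p f" .
  qed
  thus ?thesis using proj unfolding bergman_projection_bounded_def by blast
qed

theorem lemma3p1: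
  fixes \<Omega> :: "(complex ^ 'n) set"
  assumes "bounded_domain \<Omega>"
  shows "duality_index \<Omega> \<le> regularity_index \<Omega> \<and> regularity_index \<Omega> \<le> integrability_index \<Omega>"
proof -
  have \<Omega>: "open \<Omega>" "bounded \<Omega>" using assms by (auto simp: bounded_domain_def)
  have "duality_index \<Omega> \<le> regularity_index \<Omega>"
    unfolding duality_index_def regularity_index_def
    by (intro Sup_subset_mono) (auto intro: regularity_of_duality[OF \<Omega>])
  moreover have "regularity_index \<Omega> \<le> integrability_index \<Omega>"
    unfolding regularity_index_def integrability_index_def
    by (intro Sup_subset_mono) (auto intro: integrability_of_regularity[OF \<Omega>])
  ultimately show ?thesis ..
qed

end
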